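(* Let $q>1$ be a real number and suppose that $q\in\mathcal V\setminus\overline{\mathcal U}$. Then: (i) the sets $\mathcal U_q$ and $\mathcal V_q$ are closed; (ii) $|\mathcal V_q\setminus\mathcal U_q|=\aleph_0$, and $\mathcal V_q\setminus\mathcal U_q$ is a discrete set, dense in $\mathcal V_q$; (iii) each element $x\in\mathcal V_q\setminus\mathcal U_q$ has exactly $\aleph_0$ expansions in base $q$ and a finite greedy expansion in base $q$.
   Context: Let $\mathbb N=\{1,2,\dots\}$. A sequence is an element of $\{0,1,2,\dots\}^{\mathbb N}$; it is called infinite if it has infinitely many nonzero terms, and finite otherwise. Sequences are compared lexicographically. For a real $q>1$, let $\lceil q\rceil$ be the smallest integer $\ge q$ and let $J_q=[0,(\lceil q\rceil-1)/(q-1)]$. An expansion of a real number $x$ in base $q$ is a sequence $(c_i)$ of integers with $0\le c_i<q$ for all $i\ge1$ and $x=\sum_{i\ge1}c_iq^{-i}$. The greedy expansion of $x\in J_q$ in base $q$ is its lexicographically largest expansion. The quasi-greedy expansion $(a_i(x))$ of $x\in J_q\setminus\{0\}$ in base $q$ is its lexicographically largest infinite expansion; the quasi-greedy expansion of $0$ is $0^\infty$. (Both exist.) Write $(\alpha_i)=(\alpha_i(q))$ for the quasi-greedy expansion of $1$ in base $q$; one has $\alpha_1=\lceil q\rceil-1$. For a digit $c\in\{0,\dots,\alpha_1\}$ put $\overline c=\alpha_1-c$, and $\overline{c_1c_2\ldots}=\overline{c_1}\,\overline{c_2}\ldots$. $\mathcal U$ is the set of real numbers $q>1$ for which $1$ has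 exactly one expansion in base $q$, and $\overline{\mathcal U}$ is its topological closure. $\mathcal V$ is the set of real numbers $q>1$ for which $\overline{\alpha_{k+1}(q)\alpha_{k+2}(q)\ldots}\le\alpha_1(q)\alpha_2(q)\ldots$ for all $k\ge1$. One has $\mathcal U\subset\overline{\mathcal U}\subset\mathcal V$. For $q>1$, $\mathcal U_q$ is the set of real numbers $x$ having exactly one expansion in base $q$, and $$\mathcal V_q=\{x\in J_q:\ \overline{a_{n+1}(x)a_{n+2}(x)\ldots}\le\alpha_1\alpha_2\ldots\ \text{whenever } a_n(x)>0\}.$$ *)

theory Defs
  imports "HOL-Analysis.Analysis" "HOL-Library.Fun_Lexorder"
begin

text \<open>
  A sequence \<open>c\<^sub>1 c\<^sub>2 \<dots>\<close> is represented by a function \<open>c :: nat \<Rightarrow> nat\<close> indexed from 0, so that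
  \<open>c i\<close> is the mathematical term \<open>c\<^sub>i\<^sub>+\<^sub>1\<close>.
\<close>

type_synonym dseq = "nat \<Rightarrow> nat"

definition finite_seq :: "dseq \<Rightarrow> bool" where
  "finite_seq c \<longleftrightarrow> finite {i. c i \<noteq> 0}"

abbreviation infinite_seq :: "dseq \<Rightarrow> bool" where
  "infinite_seq c \<equiv> \<not> finite_seq c"

definition lex_le :: "dseq \<Rightarrow> dseq \<Rightarrow> bool" where
  "lex_le c d \<longleftrightarrow> less_fun c d \<or> c = d"

definition shift_seq :: "nat \<Rightarrow> dseq \<Rightarrow> dseq" where
  "shift_seq n c = (\<lambda>i. c (n + i))"

definition J :: "real \<Rightarrow> real set" where
  "J q = {0..(of_int \<lceil>q\<rceil> - 1) / (q - 1)}"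

definition is_expansion :: "real \<Rightarrow> real \<Rightarrow> dseq \<Rightarrow> bool" where
  "is_expansion q x c \<longleftrightarrow> (\<forall>i. real (c i) < q) \<and> (\<lambda>i. real (c i) / q ^ Suc i) sums x"

definition is_greedy_expansion :: "real \<Rightarrow> real \<Rightarrow> dseq \<Rightarrow> bool" where
  "is_greedy_expansion q x c \<longleftrightarrow>
     is_expansion q x c \<and> (\<forall>d. is_expansion q x d \<longrightarrow> lex_le d c)"

definition is_quasi_greedy_expansion :: "real \<Rightarrow> real \<Rightarrow> dseq \<Rightarrow> bool" where
  "is_quasi_greedy_expansion q x c \<longleftrightarrow>
     (if x = 0 then c = (\<lambda>_. 0)
      else is_expansion q x c \<and> infinite_seq c \<and>
           (\<forall>d. is_expansion q x d \<and> infinite_seq d \<longrightarrow> lex_le d c))"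

text \<open>
  The quasi-greedy expansion \<open>(a\<^sub>i(x))\<close>; it exists, and \<open>THE\<close> is meaningful, when \<open>q > 1\<close> and
  \<open>x \<in> J q\<close>.
\<close>

definition quasi_greedy :: "real \<Rightarrow> real \<Rightarrow> dseq" where
  "quasi_greedy q x = (THE c. is_quasi_greedy_expansion q x c)"

definition alpha :: "real \<Rightarrow> dseq" where
  "alpha q = quasi_greedy q 1"

text \<open>
  The reflection of a sequence.  It is only applied to expansions in base \<open>q > 1\<close>, whose digits do
  not exceed \<open>\<alpha>\<^sub>1 = \<lceil>q\<rceil> - 1\<close>, so the subtraction on \<open>nat\<close> does not truncate.
\<close>

definition conj_seq :: "real \<Rightarrow> dseq \<Rightarrow> dseq" where
  "conj_seq q c = (\<lambda>i. alpha q 0 - c i)"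

definition univoque_bases :: "real set" where
  "univoque_bases = {q. q > 1 \<and> (\<exists>!c. is_expansion q 1 c)}"

definition V_bases :: "real set" where
  "V_bases = {q. q > 1 \<and> (\<forall>k\<ge>1. lex_le (conj_seq q (shift_seq k (alpha q))) (alpha q))}"

definition U_set :: "real \<Rightarrow> real set" where
  "U_set q = {x. \<exists>!c. is_expansion q x c}"

text \<open>
  With indices from 0, the term \<open>a\<^sub>n(x)\<close> for \<open>n \<ge> 1\<close> is \<open>quasi_greedy q x m\<close> with \<open>n = Suc m\<close>, and
  \<open>a\<^sub>n\<^sub>+\<^sub>1(x) a\<^sub>n\<^sub>+\<^sub>2(x) \<dots>\<close> is the shift by \<open>Suc m\<close>.
\<close>

definition V_set :: "real \<Rightarrow> real set" where
  "V_set q = {x \<in> J q. \<forall>m. quasi_greedy q x m > 0 \<longrightarrow>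
     lex_le (conj_seq q (shift_seq (Suc m) (quasi_greedy q x))) (alpha q)}"

end

theory Submission
  imports Defs
begin

text \<open>
  Write \<open>A = \<alpha>\<^sub>1 = \<lceil>q\<rceil> - 1\<close>, and \<open>c'\<close> for the reflection of \<open>c\<close>. An expansion \<open>c\<close> of \<open>x\<close> is the only one iff no digit can
  be raised or lowered by 1 and compensated by the following tail, that is, iff each tail after a digit
  \<open>< A\<close> has value \<open>< 1\<close> and the reflection of each tail after a digit \<open>> 0\<close> has value \<open>< 1\<close>. Lexicographic
  and numerical comparison with \<open>\<alpha>\<close>, an expansion of 1, are linked by \<open>dval_ge_1_of_less_fun\<close> and
  \<open>dval_shift_less_1\<close>. Hence the two sets consist of the values of the sequences in \<open>V_seqs\<close>
  and \<open>U_seqs\<close>, which satisfy the inequalities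
  \<open>c\<^sub>n\<^sub>+\<^sub>1c\<^sub>n\<^sub>+\<^sub>2\<dots> \<le> \<alpha>\<close> for \<open>c\<^sub>n < A\<close> and \<open>(c\<^sub>n\<^sub>+\<^sub>1c\<^sub>n\<^sub>+\<^sub>2\<dots>)' \<le> \<alpha>\<close> for \<open>c\<^sub>n > 0\<close>, respectively their strict versions
  (\<open>V_set_eq\<close>, which requires \<open>\<alpha> \<noteq> A\<^sup>\<infinity>\<close>, and \<open>U_set_eq\<close>).

  If \<open>(\<alpha>\<^sub>n\<^sub>+\<^sub>1\<alpha>\<^sub>n\<^sub>+\<^sub>2\<dots>)' < \<alpha>\<close> for all \<open>n \<ge> 1\<close>, then \<open>q\<close> is in the closure of the univoque bases
  (\<open>in_closure_univoque_bases\<close>). If \<open>\<alpha>\<close> is not periodic, \<open>q\<close> is univoque itself. If it is periodic, \<open>\<alpha>\<close> is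
  approximated by sequences whose proper tails and their reflections are strictly smaller than the
  sequence itself; such a sequence is the unique expansion of 1 in a base close to \<open>q\<close>.

  So for the bases of the theorem \<open>\<alpha>\<^sub>k\<^sub>+\<^sub>1\<alpha>\<^sub>k\<^sub>+\<^sub>2\<dots> = \<alpha>'\<close> for some \<open>k \<ge> 1\<close>. Then \<open>\<alpha>\<close> is rigid
  (\<open>V_seqs_tail_eq_alpha\<close>): if a sequence in \<open>V_seqs\<close> contains the word \<open>\<alpha>\<^sub>1\<dots>\<alpha>\<^sub>k\<close> after a digit \<open>< A\<close>, it
  continues there as \<open>\<alpha>\<close>, because what follows the word is bounded by \<open>\<alpha>'\<close> from above and, as \<open>\<alpha>\<^sub>k > 0\<close>,
  from below. Consequently both sets of sequences are closed in a compact product space, the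
  difference set consists of values of sequences that end in \<open>\<alpha>\<close>, and each of these is determined within
  \<open>V_seqs\<close> by a finite prefix. This gives closedness, countability and discreteness. Density follows by
  replacing a suitable tail of a sequence by \<open>\<alpha>\<close> (\<open>V_seqs_approximation\<close>). Since \<open>\<alpha>\<close> is periodic, a
  sequence ending in \<open>\<alpha>\<close> has infinitely many tails \<open>\<alpha>\<close> after a digit \<open>< A\<close>; raising that digit by 1 and
  continuing with \<open>0\<^sup>\<infinity>\<close> yields infinitely many expansions, and the first such tail yields the greedy one.
\<close>

section \<open>Lexicographic order and reflection of sequences\<close>

lemma less_fun_or_ge:
  fixes c d :: dseq
  shows "less_fun c d \<or> lex_le d c"
proof (cases "c = d")
  case True
  then show ?thesis by (simp add: lex_le_def)
next
  case False
  define k where "k = (LEAST k. c k \<noteq> d k)"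
  have k: "c k \<noteq> d k" "\<And>j. j < k \<Longrightarrow> c j = d j"
    unfolding k_def using LeastI_ex[of "\<lambda>k. c k \<noteq> d k"] False not_less_Least[of _ "\<lambda>k. c k \<noteq> d k"] by blast+
  show ?thesis
  proof (cases "c k < d k")
    case True
    then show ?thesis using k by (auto intro: less_funI)
  next
    case False
    then have "less_fun d c" using k by (intro less_funI exI[of _ k]) auto
    then show ?thesis by (simp add: lex_le_def)
  qed
qed

lemma not_lex_le_iff: "\<not> lex_le c d \<longleftrightarrow> less_fun d c"
  using less_fun_or_ge[of d c] less_fun_asym less_fun_irrefl unfolding lex_le_def by blast

lemma lex_le_refl: "lex_le c c"
  by (simp add: lex_le_def)

lemma lex_le_trans: "lex_le a b \<Longrightarrow> lex_le b c \<Longrightarrow> lex_le a c"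
  unfolding lex_le_def using less_fun_trans by blast

lemma lex_le_antisym: "lex_le a b \<Longrightarrow> lex_le b a \<Longrightarrow> a = b"
  unfolding lex_le_def using less_fun_asym by blast

lemma lex_leE:
  assumes "lex_le c d"
  obtains "c = d" | k where "c k < d k" "\<And>j. j < k \<Longrightarrow> c j = d j"
  using assms unfolding lex_le_def by (auto elim: less_funE)

lemma lex_le_shift_of_prefix:
  assumes "lex_le c d" "\<And>i. i < n \<Longrightarrow> c i = d i"
  shows "lex_le (shift_seq n c) (shift_seq n d)"
  using assms(1)
proof (cases rule: lex_leE)
  case (2 k)
  then have "n \<le> k" using assms(2)[of k] by (cases "n \<le> k") auto
  then have "less_fun (shift_seq n c) (shift_seq n d)"
    using 2 by (intro less_funI exI[of _ "k - n"]) (auto simp: shift_seq_def)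
  then show ?thesis by (simp add: lex_le_def)
qed (simp add: lex_le_refl)

lemma lex_le_prefix_le:
  assumes "lex_le c d" "\<And>j. j < i \<Longrightarrow> c j = d j"
  shows "c i \<le> d i"
  using assms(1)
proof (cases rule: lex_leE)
  case (2 k)
  then show ?thesis using assms(2)[of k] by (cases k i rule: linorder_cases) auto
qed simp

lemma lex_leI:
  assumes "\<And>i. (\<And>j. j < i \<Longrightarrow> c j = d j) \<Longrightarrow> c i \<le> d i"
  shows "lex_le c d"
proof (rule ccontr)
  assume "\<not> lex_le c d"
  then obtain k where "d k < c k" "\<And>j. j < k \<Longrightarrow> d j = c j"
    unfolding not_lex_le_iff by (auto elim: less_funE)
  then show False using assms[of k] by auto
qed

lemma shift_seq_0 [simp]: "shift_seq 0 c = c"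
  by (simp add: shift_seq_def)

lemma shift_seq_shift_seq [simp]: "shift_seq m (shift_seq n c) = shift_seq (n + m) c"
  by (simp add: shift_seq_def add.assoc)

lemma finite_seq_shift_iff: "finite_seq (shift_seq n c) \<longleftrightarrow> finite_seq c"
proof
  assume "finite_seq (shift_seq n c)"
  moreover have "{i. c i \<noteq> 0} \<subseteq> {..<n} \<union> (+) n ` {i. c (n + i) \<noteq> 0}"
  proof
    fix i
    assume i: "i \<in> {i. c i \<noteq> 0}"
    show "i \<in> {..<n} \<union> (+) n ` {i. c (n + i) \<noteq> 0}"
    proof (cases "i < n")
      case False
      then have "i = n + (i - n)" "i - n \<in> {i. c (n + i) \<noteq> 0}" using i by auto
      then show ?thesis by blast
    qed simp
  qed
  ultimately show "finite_seq c"
    unfolding finite_seq_def shift_seq_def by (auto intro: finite_subset)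
next
  assume "finite_seq c"
  then have "finite ((+) n -` {i. c i \<noteq> 0})"
    unfolding finite_seq_def by (rule finite_vimageI) simp
  then show "finite_seq (shift_seq n c)"
    by (simp add: finite_seq_def shift_seq_def vimage_def)
qed

lemma infinite_seq_imp_nonzero: "infinite_seq c \<Longrightarrow> \<exists>i\<ge>n. c i \<noteq> 0"
  unfolding finite_seq_def by (auto simp: infinite_nat_iff_unbounded_le)

lemma finite_seq_imp_tail_zero: "finite_seq c \<Longrightarrow> \<exists>n. shift_seq n c = (\<lambda>_. 0)"
  unfolding finite_seq_def shift_seq_def finite_nat_iff_bounded
  by (auto simp: fun_eq_iff subset_iff)

text \<open>Sequences over the digits \<open>0, \<dots>, A\<close>.\<close>

definition digits :: "nat \<Rightarrow> dseq \<Rightarrow> bool" where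
  "digits A c \<longleftrightarrow> (\<forall>i. c i \<le> A)"

text \<open>
  Reflection with respect to an arbitrary maximal digit; it agrees with \<^const>\<open>conj_seq\<close> when
  \<open>A = \<alpha>\<^sub>1\<close>. It is an order-reversing involution on the sequences over \<open>0, \<dots>, A\<close>.
\<close>

definition reflect :: "nat \<Rightarrow> dseq \<Rightarrow> dseq" where
  "reflect A c = (\<lambda>i. A - c i)"

lemma digits_shift: "digits A c \<Longrightarrow> digits A (shift_seq n c)"
  by (simp add: digits_def shift_seq_def)

lemma digits_reflect [simp]: "digits A (reflect A c)"
  by (simp add: digits_def reflect_def)

lemma shift_reflect: "shift_seq n (reflect A c) = reflect A (shift_seq n c)"
  by (simp add: shift_seq_def reflect_def)

lemma reflect_reflect: "digits A c \<Longrightarrow> reflect A (reflect A c) = c"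
  by (simp add: digits_def reflect_def)

lemma less_fun_reflect_iff:
  assumes "digits A c" "digits A d"
  shows "less_fun (reflect A c) (reflect A d) \<longleftrightarrow> less_fun d c"
proof -
  have le: "c i \<le> A" "d i \<le> A" for i
    using assms by (auto simp: digits_def)
  have eq: "A - c i = A - d i \<longleftrightarrow> d i = c i" for i
    using le[of i] by arith
  have less: "A - c i < A - d i \<longleftrightarrow> d i < c i" for i
    using le[of i] by arith
  show ?thesis
    unfolding less_fun_def reflect_def eq less by (rule refl)
qed

lemma reflect_eq_iff:
  assumes "digits A c" "digits A d"
  shows "reflect A c = reflect A d \<longleftrightarrow> c = d"
proof
  assume "reflect A c = reflect A d"
  from arg_cong[OF this, of "reflect A"] show "c = d"
    by (simp only: reflect_reflect assms)
qed simp

lemma lex_le_reflect_iff: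
  assumes "digits A c" "digits A d"
  shows "lex_le (reflect A c) (reflect A d) \<longleftrightarrow> lex_le d c"
  using less_fun_reflect_iff[OF assms] reflect_eq_iff[OF assms] by (auto simp: lex_le_def)

section \<open>Values of sequences in a real base\<close>

text \<open>
  The value \<open>\<Sum> c\<^sub>i q\<^sup>-\<^sup>i\<close>. Like the sequences, the sum is indexed from 0; it converges for bounded \<open>c\<close> and
  \<open>q > 1\<close>.
\<close>

definition dval :: "real \<Rightarrow> dseq \<Rightarrow> real" where
  "dval q c = (\<Sum>i. real (c i) / q ^ Suc i)"

text \<open>
  The hypotheses say that \<open>q > 1\<close> and \<open>A = \<lceil>q\<rceil> - 1\<close>. They keep \<open>A\<close> fixed while \<open>q\<close> varies, which is needed
  for the approximation of a base by others.
\<close>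

locale base =
  fixes q :: real and A :: nat
  assumes q_gt_1: "1 < q" and A_less: "real A < q" and q_le: "q \<le> real A + 1"
begin

lemma A_pos: "0 < A"
  using q_gt_1 q_le by (cases A) auto

lemma bound_sums: "(\<lambda>i. real A / q ^ Suc i) sums (real A / (q - 1))"
proof -
  have "(\<lambda>i. real A / q * (1 / q) ^ i) sums (real A / q * (1 / (1 - 1 / q)))"
    using q_gt_1 by (intro sums_mult geometric_sums) auto
  moreover have "real A / q * (1 / (1 - 1 / q)) = real A / (q - 1)"
    using q_gt_1 by (simp add: field_simps)
  moreover have "real A / q * (1 / q) ^ i = real A / q ^ Suc i" for i
    by (simp add: power_divide)
  ultimately show ?thesis
    by (simp only:)
qed

lemma summable_dval:
  assumes "digits A c"
  shows "summable (\<lambda>i. real (c i) / q ^ Suc i)"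
proof (rule summable_comparison_test'[where N = 0])
  show "summable (\<lambda>i. real A / q ^ Suc i)"
    using bound_sums by (rule sums_summable)
  show "norm (real (c i) / q ^ Suc i) \<le> real A / q ^ Suc i" for i
    using assms q_gt_1 by (auto simp: digits_def intro!: divide_right_mono)
qed

lemma dval_sums:
  assumes "digits A c"
  shows "(\<lambda>i. real (c i) / q ^ Suc i) sums dval q c"
  using summable_dval[OF assms] unfolding dval_def by (rule summable_sums)

lemma dval_nonneg: "digits A c \<Longrightarrow> 0 \<le> dval q c"
  unfolding dval_def using q_gt_1 by (intro suminf_nonneg summable_dval) auto

lemma dval_pos:
  assumes "digits A c" "c i \<noteq> 0"
  shows "0 < dval q c"
  unfolding dval_def using assms q_gt_1 by (intro suminf_pos2[OF summable_dval, of _ i]) auto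

lemma dval_le: "digits A c \<Longrightarrow> dval q c \<le> real A / (q - 1)"
  using q_gt_1 by (intro sums_le[OF _ dval_sums bound_sums]) (auto simp: digits_def intro!: divide_right_mono)

lemma dval_zero [simp]: "dval q (\<lambda>_. 0) = 0"
  by (simp add: dval_def)

lemma dval_eq_0_iff: "digits A c \<Longrightarrow> dval q c = 0 \<longleftrightarrow> c = (\<lambda>_. 0)"
  using dval_pos by fastforce

lemma dval_reflect:
  assumes "digits A c"
  shows "dval q (reflect A c) = real A / (q - 1) - dval q c"
proof -
  have "(\<lambda>i. real A / q ^ Suc i - real (c i) / q ^ Suc i) sums (real A / (q - 1) - dval q c)"
    by (intro sums_diff bound_sums dval_sums assms)
  moreover have "real A / q ^ Suc i - real (c i) / q ^ Suc i = real (reflect A c i) / q ^ Suc i" for i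
    using assms by (simp add: reflect_def digits_def of_nat_diff diff_divide_distrib)
  ultimately show ?thesis
    unfolding dval_def by (simp add: sums_iff)
qed

lemma dval_split:
  assumes "digits A c"
  shows "dval q c = (\<Sum>i<n. real (c i) / q ^ Suc i) + dval q (shift_seq n c) / q ^ n"
proof -
  have "dval q c = (\<Sum>i. real (c (i + n)) / q ^ Suc (i + n)) + (\<Sum>i<n. real (c i) / q ^ Suc i)"
    unfolding dval_def by (rule suminf_split_initial_segment[OF summable_dval[OF assms]])
  also have "(\<Sum>i. real (c (i + n)) / q ^ Suc (i + n)) = (\<Sum>i. real (shift_seq n c i) / q ^ Suc i / q ^ n)"
    by (simp add: shift_seq_def power_add field_simps)
  also have "\<dots> = dval q (shift_seq n c) / q ^ n"
    unfolding dval_def using summable_dval[OF digits_shift[OF assms]] by (rule suminf_divide)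
  finally show ?thesis by simp
qed

lemma dval_shift_Suc:
  assumes "digits A c"
  shows "q * dval q (shift_seq n c) = real (c n) + dval q (shift_seq (Suc n) c)"
  using dval_split[OF digits_shift[OF assms], of n 1] q_gt_1
  by (simp add: shift_seq_def field_simps)

text \<open>The values of two sequences are compared at the first digit in which they differ.\<close>

lemma dval_diff_first:
  assumes "digits A c" "digits A d" "\<And>i. i < n \<Longrightarrow> c i = d i"
  shows "dval q c - dval q d =
    (real (c n) - real (d n) + dval q (shift_seq (Suc n) c) - dval q (shift_seq (Suc n) d)) / q ^ Suc n"
proof -
  have "(\<Sum>i<n. real (c i) / q ^ Suc i) = (\<Sum>i<n. real (d i) / q ^ Suc i)"
    using assms(3) by (intro sum.cong) auto
  then show ?thesis
    using dval_split[OF assms(1), of "Suc n"] dval_split[OF assms(2), of "Suc n"]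
    by (simp add: diff_divide_distrib add_divide_distrib)
qed

lemma dval_eq_first:
  assumes "digits A c" "digits A d" "dval q c = dval q d" "\<And>i. i < n \<Longrightarrow> c i = d i"
  shows "real (c n) + dval q (shift_seq (Suc n) c) = real (d n) + dval q (shift_seq (Suc n) d)"
  using dval_diff_first[OF assms(1,2,4)] assms(3) q_gt_1 by (simp add: field_simps)

lemma is_expansion_iff: "is_expansion q x c \<longleftrightarrow> digits A c \<and> dval q c = x"
proof -
  have "real n < q \<longleftrightarrow> n \<le> A" for n :: nat
    using A_less q_le by linarith
  then have "is_expansion q x c \<longleftrightarrow> digits A c \<and> (\<lambda>i. real (c i) / q ^ Suc i) sums x"
    by (simp add: is_expansion_def digits_def)
  then show ?thesis
    using dval_sums[of c] sums_unique2[of "\<lambda>i. real (c i) / q ^ Suc i" x "dval q c"] by auto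
qed

lemma ceiling_eq: "\<lceil>q\<rceil> = int A + 1"
  using A_less q_le by (intro ceiling_unique) auto

lemma J_eq: "J q = {0..real A / (q - 1)}"
  by (simp add: J_def ceiling_eq)

section \<open>Quasi-greedy expansions\<close>

text \<open>
  A quasi-greedy sequence is recognised by its values: after a digit that could be raised, the
  remaining tail has value at most 1.
\<close>

definition quasi_greedy_seq :: "dseq \<Rightarrow> bool" where
  "quasi_greedy_seq c \<longleftrightarrow> digits A c \<and> infinite_seq c \<and>
     (\<forall>n. c n < A \<longrightarrow> dval q (shift_seq (Suc n) c) \<le> 1)"

lemma dval_pos_of_infinite: "digits A c \<Longrightarrow> infinite_seq c \<Longrightarrow> 0 < dval q c"
  using dval_pos infinite_seq_imp_nonzero by blast

lemma quasi_greedy_seq_maximal: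
  assumes c: "quasi_greedy_seq c" and d: "digits A d" "infinite_seq d" "dval q d = dval q c"
  shows "lex_le d c"
proof (rule ccontr)
  assume "\<not> lex_le d c"
  then obtain k where k: "c k < d k" "\<And>j. j < k \<Longrightarrow> c j = d j"
    unfolding not_lex_le_iff by (auto elim: less_funE)
  have "digits A c" "dval q (shift_seq (Suc k) c) \<le> 1"
    using c k(1) d(1) by (auto simp: quasi_greedy_seq_def digits_def less_le_trans)
  moreover have "0 < dval q (shift_seq (Suc k) d)"
    using d(1,2) by (intro dval_pos_of_infinite) (auto simp: digits_shift finite_seq_shift_iff)
  moreover have "real (c k) + 1 \<le> real (d k)" using k(1) by linarith
  ultimately show False
    using dval_eq_first[of c d k] d k(2) by auto
qed

lemma quasi_greedy_eqI:
  assumes "quasi_greedy_seq c"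
  shows "quasi_greedy q (dval q c) = c"
proof -
  have c: "digits A c" "infinite_seq c" using assms by (auto simp: quasi_greedy_seq_def)
  then have "0 < dval q c" by (rule dval_pos_of_infinite)
  with c have "is_quasi_greedy_expansion q (dval q c) c"
    using quasi_greedy_seq_maximal[OF assms]
    by (simp add: is_quasi_greedy_expansion_def is_expansion_iff)
  moreover have "d = c" if "is_quasi_greedy_expansion q (dval q c) d" for d
    using that c \<open>0 < dval q c\<close> quasi_greedy_seq_maximal[OF assms]
    by (auto simp: is_quasi_greedy_expansion_def is_expansion_iff intro: lex_le_antisym)
  ultimately show ?thesis
    unfolding quasi_greedy_def by (rule the_equality)
qed

lemma quasi_greedy_0: "quasi_greedy q 0 = (\<lambda>_. 0)"
  by (simp add: quasi_greedy_def is_quasi_greedy_expansion_def)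

text \<open>
  The quasi-greedy algorithm: the remainder \<open>r > 0\<close> is multiplied by \<open>q\<close>, and the largest digit
  strictly below \<open>q r\<close> is taken off.
\<close>

definition next_digit :: "real \<Rightarrow> nat" where
  "next_digit r = min A (nat (\<lceil>q * r\<rceil> - 1))"

primrec remainder :: "real \<Rightarrow> nat \<Rightarrow> real" where
  "remainder x 0 = x"
| "remainder x (Suc n) = q * remainder x n - real (next_digit (remainder x n))"

lemma next_remainder:
  assumes "0 < r" "r \<le> real A / (q - 1)"
  shows "0 < q * r - real (next_digit r)" "q * r - real (next_digit r) \<le> real A / (q - 1)"
    and "next_digit r < A \<Longrightarrow> q * r - real (next_digit r) \<le> 1"
proof -
  have qr: "0 < q * r" using assms q_gt_1 by simp
  then have c: "real (nat (\<lceil>q * r\<rceil> - 1)) = of_int \<lceil>q * r\<rceil> - 1" by simp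
  have "real (next_digit r) \<le> of_int \<lceil>q * r\<rceil> - 1"
    unfolding c[symmetric] by (simp add: next_digit_def)
  then show "0 < q * r - real (next_digit r)" by linarith
  show 1: "q * r - real (next_digit r) \<le> 1" if "next_digit r < A"
    using that c unfolding next_digit_def by (auto simp: min_def split: if_splits)
  have "1 \<le> real A / (q - 1)" using q_gt_1 q_le by simp
  moreover have "q * r - real A \<le> real A / (q - 1)"
  proof -
    have "q * r \<le> q * (real A / (q - 1))"
      using assms(2) q_gt_1 by (intro mult_left_mono) auto
    also have "q * (real A / (q - 1)) = real A + real A / (q - 1)"
      using q_gt_1 by (simp add: field_simps)
    finally show ?thesis by simp
  qed
  moreover have "next_digit r < A \<or> next_digit r = A" by (auto simp: next_digit_def)
  ultimately show "q * r - real (next_digit r) \<le> real A / (q - 1)"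
    using 1 by fastforce
qed

lemma quasi_greedy_seq_exists:
  assumes "0 < x" "x \<le> real A / (q - 1)"
  obtains c where "quasi_greedy_seq c" "dval q c = x"
proof -
  define c where "c n = next_digit (remainder x n)" for n
  have inv: "0 < remainder x n \<and> remainder x n \<le> real A / (q - 1)" for n
    using assms next_remainder by (induction n) auto
  have dig: "digits A c" by (simp add: digits_def c_def next_digit_def)
  have part: "x = (\<Sum>i<n. real (c i) / q ^ Suc i) + remainder x n / q ^ n" for n
  proof (induction n)
    case (Suc n)
    have "remainder x n / q ^ n = real (c n) / q ^ Suc n + remainder x (Suc n) / q ^ Suc n"
      using q_gt_1 by (simp add: c_def field_simps)
    with Suc show ?case by simp
  qed simp
  have "(\<lambda>n. remainder x n / q ^ n) \<longlonglongrightarrow> 0"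
  proof (rule tendsto_sandwich[of "\<lambda>_. 0" _ _ "\<lambda>n. real A / (q - 1) / q ^ n"])
    show "\<forall>\<^sub>F n in sequentially. remainder x n / q ^ n \<le> real A / (q - 1) / q ^ n"
      using inv q_gt_1 by (intro always_eventually allI divide_right_mono) auto
    show "\<forall>\<^sub>F n in sequentially. 0 \<le> remainder x n / q ^ n"
      using inv q_gt_1 by (intro always_eventually allI divide_nonneg_nonneg) (auto simp: less_imp_le)
    have "(\<lambda>n. real A / (q - 1) * (1 / q) ^ n) \<longlonglongrightarrow> real A / (q - 1) * 0"
      using q_gt_1 by (intro tendsto_mult tendsto_const LIMSEQ_realpow_zero) auto
    then show "(\<lambda>n. real A / (q - 1) / q ^ n) \<longlonglongrightarrow> 0"
      by (simp add: power_divide)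
  qed simp
  then have "(\<lambda>n. x - remainder x n / q ^ n) \<longlonglongrightarrow> x - 0"
    by (intro tendsto_diff tendsto_const)
  moreover have "x - remainder x n / q ^ n = (\<Sum>i<n. real (c i) / q ^ Suc i)" for n
    using part[of n] by linarith
  ultimately have "(\<lambda>i. real (c i) / q ^ Suc i) sums x"
    by (simp add: sums_def)
  then have val: "dval q c = x" by (simp add: dval_def sums_iff)
  have tail: "dval q (shift_seq n c) = remainder x n" for n
    using dval_split[OF dig, of n] part[of n] val q_gt_1 by (simp add: field_simps)
  have "infinite_seq c"
  proof
    assume "finite_seq c"
    then obtain n where "shift_seq n c = (\<lambda>_. 0)" using finite_seq_imp_tail_zero by blast
    with tail[of n] inv[of n] show False by simp
  qed
  moreover have "dval q (shift_seq (Suc n) c) \<le> 1" if "c n < A" for n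
    using that inv[of n] next_remainder(3)[of "remainder x n"] unfolding tail by (simp add: c_def)
  ultimately have "quasi_greedy_seq c" using dig by (simp add: quasi_greedy_seq_def)
  with val show ?thesis by (intro that)
qed

lemma one_le_max: "1 \<le> real A / (q - 1)"
  using q_gt_1 q_le by simp

lemma quasi_greedy_seq_alpha: "quasi_greedy_seq (alpha q)"
  and dval_alpha: "dval q (alpha q) = 1"
proof -
  obtain c where c: "quasi_greedy_seq c" "dval q c = 1"
    using quasi_greedy_seq_exists[OF zero_less_one one_le_max] .
  then have "alpha q = c" using quasi_greedy_eqI[OF c(1)] by (simp add: alpha_def)
  with c show "quasi_greedy_seq (alpha q)" "dval q (alpha q) = 1" by auto
qed

lemma digits_alpha: "digits A (alpha q)" and infinite_alpha: "infinite_seq (alpha q)"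
  using quasi_greedy_seq_alpha by (auto simp: quasi_greedy_seq_def)

lemma alpha_0: "alpha q 0 = A"
proof (rule ccontr)
  assume "alpha q 0 \<noteq> A"
  then have less: "alpha q 0 < A" using digits_alpha by (auto simp: digits_def le_neq_implies_less)
  then have "dval q (shift_seq (Suc 0) (alpha q)) \<le> 1"
    using quasi_greedy_seq_alpha unfolding quasi_greedy_seq_def by blast
  moreover have "real (alpha q 0) + 1 \<le> real A" using less by linarith
  ultimately show False
    using dval_shift_Suc[OF digits_alpha, of 0] dval_alpha A_less by simp
qed

lemma conj_seq_eq: "conj_seq q c = reflect A c"
  by (simp add: conj_seq_def reflect_def alpha_0)

lemma dval_shift_alpha_le: "dval q (shift_seq n (alpha q)) \<le> 1"
proof (induction n)
  case (Suc n)
  show ?case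
  proof (cases "alpha q n < A")
    case True
    then show ?thesis using quasi_greedy_seq_alpha unfolding quasi_greedy_seq_def by blast
  next
    case False
    then have "real A \<le> real (alpha q n)" by simp
    moreover have "q * dval q (shift_seq n (alpha q)) \<le> q * 1"
      using Suc q_gt_1 by simp
    ultimately show ?thesis
      using dval_shift_Suc[OF digits_alpha, of n] q_le by simp
  qed
qed (simp add: dval_alpha)

lemma dval_ge_1_of_less_fun:
  assumes "digits A d" "less_fun (alpha q) d"
  shows "1 \<le> dval q d" "infinite_seq d \<Longrightarrow> 1 < dval q d"
proof -
  from assms(2) obtain k where k: "alpha q k < d k" "\<And>j. j < k \<Longrightarrow> alpha q j = d j"
    by (auto elim: less_funE)
  let ?D = "real (d k) - real (alpha q k) + dval q (shift_seq (Suc k) d)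
    - dval q (shift_seq (Suc k) (alpha q))"
  have eq: "dval q d - 1 = ?D / q ^ Suc k"
    using dval_diff_first[OF assms(1) digits_alpha, of k] k(2) by (simp add: dval_alpha)
  have le: "dval q (shift_seq (Suc k) d) \<le> ?D"
    using k(1) dval_shift_alpha_le[of "Suc k"] by linarith
  have "0 \<le> ?D"
    using le dval_nonneg[OF digits_shift[OF assms(1)], of "Suc k"] by linarith
  then show "1 \<le> dval q d" using eq q_gt_1
    by (metis diff_ge_0_iff_ge divide_nonneg_pos less_trans zero_less_one zero_less_power)
  assume "infinite_seq d"
  then have "0 < dval q (shift_seq (Suc k) d)"
    using assms(1) by (intro dval_pos_of_infinite) (auto simp: digits_shift finite_seq_shift_iff)
  then have "0 < ?D" using le by linarith
  then show "1 < dval q d" using eq q_gt_1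
    by (metis diff_gt_0_iff_gt divide_pos_pos less_trans zero_less_one zero_less_power)
qed

lemma quasi_greedy_seq_lex_le:
  assumes "quasi_greedy_seq c" "c n < A"
  shows "lex_le (shift_seq (Suc n) c) (alpha q)"
proof (rule ccontr)
  assume "\<not> ?thesis"
  then have "1 < dval q (shift_seq (Suc n) c)"
    using assms(1) unfolding not_lex_le_iff
    by (intro dval_ge_1_of_less_fun) (auto simp: quasi_greedy_seq_def digits_shift finite_seq_shift_iff)
  with assms show False unfolding quasi_greedy_seq_def by force
qed

lemma shift_alpha_lex_le: "lex_le (shift_seq n (alpha q)) (alpha q)"
proof (rule ccontr)
  assume "\<not> ?thesis"
  then have "1 < dval q (shift_seq n (alpha q))"
    unfolding not_lex_le_iff
    by (intro dval_ge_1_of_less_fun) (auto simp: digits_alpha infinite_alpha digits_shift finite_seq_shift_iff)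
  with dval_shift_alpha_le[of n] show False by simp
qed

text \<open>
  Conversely, lexicographic bounds on all tails that follow a digit below \<open>A\<close> bound the values of
  these tails.  At the first difference from \<open>b\<close> the tail has a digit below \<open>A\<close>, so that the bound
  applies again to what follows; each such step shrinks the possible excess over 1 by a factor of
  at least \<open>q\<close>.
\<close>

lemma dval_shift_less_1:
  assumes b: "digits A b" "infinite_seq b" "dval q b = 1"
    and c: "digits A c" "\<And>n. c n < A \<Longrightarrow> lex_le (shift_seq (Suc n) c) b"
    and n: "c n < A"
  shows dval_shift_le_1: "dval q (shift_seq (Suc n) c) \<le> 1"
    and "shift_seq (Suc n) c \<noteq> b \<Longrightarrow> dval q (shift_seq (Suc n) c) < 1"
proof -
  define B where "B = real A / (q - 1)"
  have "0 \<le> B" using q_gt_1 by (simp add: B_def)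
  \<comment> \<open>Strictness uses that the tail of the infinite sequence \<open>b\<close> has positive value.\<close>
  have step: "\<exists>m k. c m < A \<and>
      dval q (shift_seq (Suc n) c) - 1 < (dval q (shift_seq (Suc m) c) - 1) / q ^ Suc k"
    if n: "c n < A" and ne: "shift_seq (Suc n) c \<noteq> b" for n
  proof -
    let ?d = "shift_seq (Suc n) c"
    obtain k where k: "?d k < b k" "\<And>j. j < k \<Longrightarrow> ?d j = b j"
      using c(2)[OF n] ne by (auto elim: lex_leE)
    have "?d k < A" using k(1) b(1) by (meson digits_def less_le_trans)
    then have m: "c (Suc n + k) < A" by (simp add: shift_seq_def)
    have "0 < dval q (shift_seq (Suc k) b)"
      using b by (intro dval_pos_of_infinite) (auto simp: digits_shift finite_seq_shift_iff)
    moreover have "real (?d k) + 1 \<le> real (b k)" using k(1) by linarith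
    ultimately have "real (?d k) - real (b k) + dval q (shift_seq (Suc k) ?d) - dval q (shift_seq (Suc k) b)
        < dval q (shift_seq (Suc (Suc n + k)) c) - 1"
      by simp
    moreover have "dval q ?d - 1 =
      (real (?d k) - real (b k) + dval q (shift_seq (Suc k) ?d) - dval q (shift_seq (Suc k) b)) / q ^ Suc k"
      using dval_diff_first[OF digits_shift[OF c(1)] b(1), where n = k] k(2) b(3) by simp
    ultimately have "dval q ?d - 1 < (dval q (shift_seq (Suc (Suc n + k)) c) - 1) / q ^ Suc k"
      using q_gt_1 by (simp add: divide_strict_right_mono)
    with m show ?thesis by blast
  qed
  have bound: "dval q (shift_seq (Suc n) c) - 1 \<le> B * (1 / q) ^ j" if "c n < A" for n j
    using that
  proof (induction j arbitrary: n)
    case 0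
    then show ?case using dval_le[OF digits_shift[OF c(1)], of "Suc n"] by (simp add: B_def)
  next
    case (Suc j)
    show ?case
    proof (cases "shift_seq (Suc n) c = b")
      case True
      then show ?thesis using b(3) \<open>0 \<le> B\<close> q_gt_1 by simp
    next
      case False
      then obtain m k where mk: "c m < A"
        "dval q (shift_seq (Suc n) c) - 1 < (dval q (shift_seq (Suc m) c) - 1) / q ^ Suc k"
        using step Suc.prems by blast
      have "(dval q (shift_seq (Suc m) c) - 1) / q ^ Suc k \<le> B * (1 / q) ^ j / q ^ Suc k"
        using Suc.IH[OF mk(1)] q_gt_1 by (intro divide_right_mono) auto
      also have "\<dots> \<le> B * (1 / q) ^ j / q ^ 1"
        using \<open>0 \<le> B\<close> q_gt_1 by (intro divide_left_mono power_increasing mult_pos_pos) auto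
      also have "\<dots> = B * (1 / q) ^ Suc j" by simp
      finally show ?thesis using mk(2) by linarith
    qed
  qed
  have le: "dval q (shift_seq (Suc n) c) \<le> 1" if "c n < A" for n
  proof -
    have "(\<lambda>j. B * (1 / q) ^ j) \<longlonglongrightarrow> B * 0"
      using q_gt_1 by (intro tendsto_mult tendsto_const LIMSEQ_realpow_zero) auto
    then have "dval q (shift_seq (Suc n) c) - 1 \<le> B * 0"
      using bound[OF that] by (intro LIMSEQ_le_const) auto
    then show ?thesis by simp
  qed
  show "dval q (shift_seq (Suc n) c) \<le> 1" using le n .
  show "dval q (shift_seq (Suc n) c) < 1" if ne: "shift_seq (Suc n) c \<noteq> b"
  proof -
    obtain m k where mk: "c m < A"
      "dval q (shift_seq (Suc n) c) - 1 < (dval q (shift_seq (Suc m) c) - 1) / q ^ Suc k"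
      using step[OF n ne] by blast
    moreover have "(dval q (shift_seq (Suc m) c) - 1) / q ^ Suc k \<le> 0"
      using le[OF mk(1)] q_gt_1 by (intro divide_nonpos_pos) auto
    ultimately show ?thesis by linarith
  qed
qed

section \<open>Unique expansions\<close>

lemma expansion_exists:
  assumes "0 \<le> x" "x \<le> real A / (q - 1)"
  obtains c where "digits A c" "dval q c = x"
proof (cases "x = 0")
  case True
  then show ?thesis using that[of "\<lambda>_. 0"] by (simp add: digits_def)
next
  case False
  then show ?thesis using assms quasi_greedy_seq_exists[of x] that by (auto simp: quasi_greedy_seq_def)
qed

text \<open>
  A second expansion of the same value exists as soon as some digit can be raised or lowered by 1
  and the remaining tail can compensate for this.
\<close>

lemma unique_imp_dval_shift_less_1:
  assumes c: "digits A c" and uniq: "\<And>d. digits A d \<Longrightarrow> dval q d = dval q c \<Longrightarrow> d = c"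
    and n: "c n < A"
  shows "dval q (shift_seq (Suc n) c) < 1"
proof (rule ccontr)
  assume "\<not> ?thesis"
  then obtain e where e: "digits A e" "dval q e = dval q (shift_seq (Suc n) c) - 1"
    using expansion_exists[of "dval q (shift_seq (Suc n) c) - 1"]
      dval_le[OF digits_shift[OF c], of "Suc n"] by force
  define d where "d i = (if i < n then c i else if i = n then Suc (c n) else e (i - Suc n))" for i
  have d: "digits A d" using c e(1) n by (auto simp: d_def digits_def)
  have "shift_seq (Suc n) d = e" by (auto simp: shift_seq_def d_def)
  then have "dval q d - dval q c = 0"
    using dval_diff_first[OF d c, of n] e(2) by (simp add: d_def)
  then have "d = c" using uniq d by simp
  then show False by (auto simp: d_def fun_eq_iff dest: spec[of _ n])
qed

lemma unique_imp_dval_shift_reflect_less_1: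
  assumes c: "digits A c" and uniq: "\<And>d. digits A d \<Longrightarrow> dval q d = dval q c \<Longrightarrow> d = c"
    and n: "0 < c n"
  shows "dval q (reflect A (shift_seq (Suc n) c)) < 1"
proof -
  have "d = reflect A c" if "digits A d" "dval q d = dval q (reflect A c)" for d
  proof -
    have "dval q (reflect A d) = dval q c" using that c by (simp add: dval_reflect)
    then show ?thesis using uniq[of "reflect A d"] that(1) by (metis digits_reflect reflect_reflect)
  qed
  moreover have "reflect A c n < A" using n A_pos by (auto simp: reflect_def)
  ultimately show ?thesis
    using unique_imp_dval_shift_less_1[of "reflect A c" n] by (simp add: shift_reflect)
qed

lemma unique_of_dval_shift_less_1:
  assumes c: "digits A c" and d: "digits A d" "dval q d = dval q c"
    and up: "\<And>n. c n < A \<Longrightarrow> dval q (shift_seq (Suc n) c) < 1"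
    and down: "\<And>n. 0 < c n \<Longrightarrow> dval q (reflect A (shift_seq (Suc n) c)) < 1"
  shows "d = c"
proof (rule ccontr)
  assume "d \<noteq> c"
  then have "less_fun d c \<or> less_fun c d" using less_fun_or_ge[of c d] by (auto simp: lex_le_def)
  then obtain k where k: "c k \<noteq> d k" "\<And>j. j < k \<Longrightarrow> c j = d j"
    by (auto elim!: less_funE) (metis less_irrefl)+
  have eq: "real (c k) + dval q (shift_seq (Suc k) c) = real (d k) + dval q (shift_seq (Suc k) d)"
    using dval_eq_first[OF c d(1)] d(2) k(2) by simp
  have bounds: "0 \<le> dval q (shift_seq (Suc k) d)" "dval q (shift_seq (Suc k) d) \<le> real A / (q - 1)"
    using d(1) dval_nonneg dval_le digits_shift by blast+
  consider "c k < d k" | "d k < c k" using k(1) by linarith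
  then show False
  proof cases
    case 1
    then have "c k < A" using d(1) by (meson digits_def less_le_trans)
    from up[OF this] 1 eq bounds show False by linarith
  next
    case 2
    then have "0 < c k" by simp
    from down[OF this] have "real A / (q - 1) - dval q (shift_seq (Suc k) c) < 1"
      using c by (simp add: dval_reflect digits_shift)
    with 2 eq bounds show False by linarith
  qed
qed

section \<open>Lexicographic description of the two sets\<close>

text \<open>
  The sequences satisfying the bound on reflected tails from the definition of \<^const>\<open>V_set\<close> and the
  analogous bound on the tails themselves, which is automatic for quasi-greedy expansions. They are not
  required to be infinite.
\<close>

definition V_seqs :: "dseq set" where
  "V_seqs = {c. digits A c \<and>
     (\<forall>n. (c n < A \<longrightarrow> lex_le (shift_seq (Suc n) c) (alpha q)) \<and>
          (0 < c n \<longrightarrow> lex_le (reflect A (shift_seq (Suc n) c)) (alpha q)))}"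

text \<open>The sequences for which all these inequalities are strict.\<close>

definition U_seqs :: "dseq set" where
  "U_seqs = {c \<in> V_seqs.
     \<forall>n. (c n < A \<longrightarrow> shift_seq (Suc n) c \<noteq> alpha q) \<and>
         (0 < c n \<longrightarrow> reflect A (shift_seq (Suc n) c) \<noteq> alpha q)}"

lemma V_seqs_digits: "c \<in> V_seqs \<Longrightarrow> digits A c"
  by (simp add: V_seqs_def)

lemma reflect_V_seqs: "c \<in> V_seqs \<Longrightarrow> reflect A c \<in> V_seqs"
  unfolding V_seqs_def
  by (auto simp: shift_reflect reflect_reflect digits_shift) (auto simp: reflect_def)

lemma dval_shift_V_seqs:
  assumes "c \<in> V_seqs" "c n < A"
  shows "dval q (shift_seq (Suc n) c) \<le> 1"
    and "shift_seq (Suc n) c \<noteq> alpha q \<Longrightarrow> dval q (shift_seq (Suc n) c) < 1"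
  using dval_shift_less_1[OF digits_alpha infinite_alpha dval_alpha, of c n] assms
  by (auto simp: V_seqs_def)

lemma dval_reflect_shift_V_seqs:
  assumes "c \<in> V_seqs" "0 < c n"
  shows "dval q (reflect A (shift_seq (Suc n) c)) \<le> 1"
    and "reflect A (shift_seq (Suc n) c) \<noteq> alpha q \<Longrightarrow> dval q (reflect A (shift_seq (Suc n) c)) < 1"
proof -
  have "reflect A c n < A" using assms(2) A_pos by (simp add: reflect_def)
  then show "dval q (reflect A (shift_seq (Suc n) c)) \<le> 1"
    "reflect A (shift_seq (Suc n) c) \<noteq> alpha q \<Longrightarrow> dval q (reflect A (shift_seq (Suc n) c)) < 1"
    using dval_shift_V_seqs[OF reflect_V_seqs[OF assms(1)], of n] by (simp_all add: shift_reflect)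
qed

lemma quasi_greedy_seq_V_seqs: "c \<in> V_seqs \<Longrightarrow> infinite_seq c \<Longrightarrow> quasi_greedy_seq c"
  using dval_shift_V_seqs(1) by (simp add: quasi_greedy_seq_def V_seqs_digits)

lemma zero_V_seqs: "(\<lambda>_. 0) \<in> V_seqs"
proof -
  have "lex_le (\<lambda>_. 0) (alpha q)" by (rule lex_leI) simp
  then show ?thesis by (simp add: V_seqs_def digits_def shift_seq_def)
qed

text \<open>
  A finite nonzero sequence ends in \<open>c\<^sub>n 0\<^sup>\<infinity>\<close> with \<open>c\<^sub>n > 0\<close>. The reflection of the tail after \<open>c\<^sub>n\<close>
  is \<open>A\<^sup>\<infinity>\<close>, which exceeds \<open>\<alpha>\<close> unless \<open>\<alpha> = A\<^sup>\<infinity>\<close>.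
\<close>

lemma finite_V_seqs:
  assumes alpha: "alpha q \<noteq> (\<lambda>_. A)" and c: "c \<in> V_seqs" "finite_seq c"
  shows "c = (\<lambda>_. 0)"
proof (rule ccontr)
  assume "c \<noteq> (\<lambda>_. 0)"
  then have ne: "{i. c i \<noteq> 0} \<noteq> {}" by auto
  define n where "n = Max {i. c i \<noteq> 0}"
  have fin: "finite {i. c i \<noteq> 0}" using c(2) by (simp add: finite_seq_def)
  have n: "0 < c n" using Max_in[OF fin ne] by (simp add: n_def)
  have "c i = 0" if "n < i" for i
    using that Max_ge[OF fin, of i] unfolding n_def by auto
  then have zero: "shift_seq (Suc n) c = (\<lambda>_. 0)" by (auto simp: shift_seq_def)
  have "lex_le (reflect A (shift_seq (Suc n) c)) (alpha q)"
    using c(1) n by (simp add: V_seqs_def)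
  then have "lex_le (\<lambda>_. A) (alpha q)" by (simp add: zero reflect_def)
  moreover have "lex_le (alpha q) (\<lambda>_. A)"
    using digits_alpha by (intro lex_leI) (simp add: digits_def)
  ultimately show False using alpha lex_le_antisym by blast
qed

lemma quasi_greedy_dval_V_seqs:
  assumes "alpha q \<noteq> (\<lambda>_. A)" "c \<in> V_seqs"
  shows "quasi_greedy q (dval q c) = c"
proof (cases "finite_seq c")
  case True
  then have "c = (\<lambda>_. 0)" using finite_V_seqs assms by blast
  then show ?thesis by (simp add: quasi_greedy_0)
next
  case False
  then show ?thesis using quasi_greedy_eqI quasi_greedy_seq_V_seqs assms by blast
qed

lemma inj_on_dval_V_seqs: "alpha q \<noteq> (\<lambda>_. A) \<Longrightarrow> inj_on (dval q) V_seqs"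
  by (metis inj_onI quasi_greedy_dval_V_seqs)

lemma V_set_eq:
  assumes "alpha q \<noteq> (\<lambda>_. A)"
  shows "V_set q = dval q ` V_seqs"
proof
  show "V_set q \<subseteq> dval q ` V_seqs"
  proof
    fix x assume x: "x \<in> V_set q"
    show "x \<in> dval q ` V_seqs"
    proof (cases "x = 0")
      case True
      then show ?thesis using zero_V_seqs by (force intro: image_eqI[of _ _ "\<lambda>_. 0"])
    next
      case False
      with x have "0 < x" "x \<le> real A / (q - 1)" by (auto simp: V_set_def J_eq)
      then obtain c where c: "quasi_greedy_seq c" "dval q c = x" by (rule quasi_greedy_seq_exists)
      have "quasi_greedy q x = c" using quasi_greedy_eqI[OF c(1)] c(2) by simp
      with x have "lex_le (reflect A (shift_seq (Suc n) c)) (alpha q)" if "0 < c n" for n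
        using that by (simp add: V_set_def conj_seq_eq)
      with c(1) have "c \<in> V_seqs"
        using quasi_greedy_seq_lex_le[OF c(1)] by (simp add: V_seqs_def quasi_greedy_seq_def)
      with c(2) show ?thesis by blast
    qed
  qed
  show "dval q ` V_seqs \<subseteq> V_set q"
  proof
    fix x assume "x \<in> dval q ` V_seqs"
    then obtain c where c: "c \<in> V_seqs" "x = dval q c" by blast
    then show "x \<in> V_set q"
      using dval_nonneg[of c] dval_le[of c] quasi_greedy_dval_V_seqs[OF assms c(1)] V_seqs_digits[OF c(1)]
      by (simp add: V_set_def J_eq conj_seq_eq V_seqs_def)
  qed
qed

lemma U_set_eq: "U_set q = dval q ` U_seqs"
proof
  show "U_set q \<subseteq> dval q ` U_seqs"
  proof
    fix x assume "x \<in> U_set q"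
    then obtain c where c: "digits A c" "dval q c = x"
      and uniq: "\<And>d. digits A d \<Longrightarrow> dval q d = dval q c \<Longrightarrow> d = c"
      by (auto simp: U_set_def is_expansion_iff)
    have *: "less_fun d (alpha q)" if "digits A d" "dval q d < 1" for d
      using that dval_ge_1_of_less_fun(1)[of d] less_fun_or_ge[of d "alpha q"] dval_alpha
      by (fastforce simp: lex_le_def)
    have up: "less_fun (shift_seq (Suc n) c) (alpha q)" if "c n < A" for n
      using unique_imp_dval_shift_less_1[OF c(1) uniq that] c(1) by (intro * digits_shift)
    have down: "less_fun (reflect A (shift_seq (Suc n) c)) (alpha q)" if "0 < c n" for n
      using unique_imp_dval_shift_reflect_less_1[OF c(1) uniq that] by (intro * digits_reflect)
    have "lex_le d (alpha q) \<and> d \<noteq> alpha q" if "less_fun d (alpha q)" for d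
      using that less_fun_irrefl by (auto simp: lex_le_def)
    then have "c \<in> U_seqs"
      using up down c(1) by (simp add: U_seqs_def V_seqs_def)
    with c(2) show "x \<in> dval q ` U_seqs" by blast
  qed
  show "dval q ` U_seqs \<subseteq> U_set q"
  proof
    fix x assume "x \<in> dval q ` U_seqs"
    then obtain c where c: "c \<in> U_seqs" "x = dval q c" by blast
    then have cV: "c \<in> V_seqs" by (simp add: U_seqs_def)
    have "d = c" if "digits A d" "dval q d = x" for d
    proof (rule unique_of_dval_shift_less_1)
      show "digits A c" using cV by (rule V_seqs_digits)
      show "digits A d" "dval q d = dval q c" using that c(2) by auto
      show "dval q (shift_seq (Suc n) c) < 1" if "c n < A" for n
        using dval_shift_V_seqs(2)[OF cV that] c(1) that by (simp add: U_seqs_def)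
      show "dval q (reflect A (shift_seq (Suc n) c)) < 1" if "0 < c n" for n
        using dval_reflect_shift_V_seqs(2)[OF cV that] c(1) that by (simp add: U_seqs_def)
    qed
    then show "x \<in> U_set q"
      using c(2) V_seqs_digits[OF cV] unfolding U_set_def is_expansion_iff by blast
  qed
qed

section \<open>Compactness\<close>

lemma compact_digits: "compact {c. digits A c}"
proof -
  have "compactin (product_topology (\<lambda>_. euclidean) UNIV) (PiE UNIV (\<lambda>_::nat. {..A}))"
    unfolding compactin_PiE by (simp add: finite_imp_compact)
  then have "compact (PiE UNIV (\<lambda>_::nat. {..A}))"
    by (simp add: euclidean_product_topology)
  moreover have "PiE UNIV (\<lambda>_::nat. {..A}) = {c. digits A c}"
    by (auto simp: digits_def PiE_iff)
  ultimately show ?thesis by simp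
qed

lemma continuous_on_dval: "continuous_on {c. digits A c} (dval q)"
proof (rule uniform_limit_theorem)
  show "uniform_limit {c. digits A c} (\<lambda>n c. \<Sum>i<n. real (c i) / q ^ Suc i) (dval q) sequentially"
    unfolding dval_def
  proof (rule Weierstrass_m_test)
    show "summable (\<lambda>i. real A / q ^ Suc i)" using bound_sums by (rule sums_summable)
    show "norm (real (c i) / q ^ Suc i) \<le> real A / q ^ Suc i" if "c \<in> {c. digits A c}" for i c
      using that q_gt_1 by (auto simp: digits_def intro!: divide_right_mono)
  qed
  have "continuous_on S (\<lambda>c::dseq. real (c i))" for S i
    by (intro continuous_on_of_nat continuous_on_subset[OF continuous_on_product_coordinates]) simp
  then show "\<forall>\<^sub>F n in sequentially. continuous_on {c. digits A c} (\<lambda>c. \<Sum>i<n. real (c i) / q ^ Suc i)"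
    using q_gt_1 by (intro always_eventually allI continuous_on_sum continuous_on_divide continuous_on_const) auto
qed simp

lemma compact_dval_image:
  assumes "closed S" "S \<subseteq> {c. digits A c}"
  shows "compact (dval q ` S)"
proof -
  have "compact S"
    using assms compact_Int_closed[OF compact_digits assms(1)] by (simp add: Int_absorb1)
  then show ?thesis
    using continuous_on_subset[OF continuous_on_dval assms(2)] by (intro compact_continuous_image)
qed

end

lemma open_coordinates:
  fixes P :: "'b \<Rightarrow> nat \<Rightarrow> bool" and f :: "'b \<Rightarrow> nat"
  assumes "finite I"
  shows "open {c::dseq. \<forall>j\<in>I. P j (c (f j))}"
  using product_topology_basis'[of I "\<lambda>j. Collect (P j)" f] assms by (simp add: open_discrete)

lemma open_coordinate: "open {c::dseq. P (c m)}"
  using open_coordinates[of "{()}" "\<lambda>_. P" "\<lambda>_. m"] by simp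

lemma closed_coordinate: "closed {c::dseq. P (c m)}"
  using open_coordinate[of "\<lambda>x. \<not> P x" m] by (simp add: closed_def Collect_neg_eq)

lemma closed_ex_coordinates:
  fixes P :: "'b \<Rightarrow> nat \<Rightarrow> bool" and f :: "'b \<Rightarrow> nat"
  assumes "finite I"
  shows "closed {c::dseq. \<exists>j\<in>I. P j (c (f j))}"
proof -
  have "- {c::dseq. \<exists>j\<in>I. P j (c (f j))} = {c. \<forall>j\<in>I. \<not> P j (c (f j))}" by auto
  then show ?thesis using open_coordinates[OF assms, of "\<lambda>j x. \<not> P j x" f] by (simp add: closed_def)
qed

lemma lex_le_iff: "lex_le c d \<longleftrightarrow> (\<forall>i. (\<forall>j\<in>{..<i}. c j = d j) \<longrightarrow> c i \<le> d i)"
  using lex_le_prefix_le[of c d] by (auto intro: lex_leI)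

lemma closed_lex_le_map_shift:
  "closed {c::dseq. lex_le (\<lambda>i. g (c (n + i))) d}"
  unfolding lex_le_iff
  by (intro closed_Collect_all closed_Collect_imp closed_coordinate open_coordinates) simp

lemma (in base) closed_V_seqs: "closed V_seqs"
proof -
  have "V_seqs = {c. (\<forall>n. c n \<le> A) \<and>
     (\<forall>n. (c n < A \<longrightarrow> lex_le (\<lambda>i. id (c (Suc n + i))) (alpha q)) \<and>
          (0 < c n \<longrightarrow> lex_le (\<lambda>i. A - c (Suc n + i)) (alpha q)))}"
    unfolding V_seqs_def digits_def shift_seq_def reflect_def by simp
  also have "closed \<dots>"
    by (intro closed_Collect_all closed_Collect_conj closed_Collect_imp closed_coordinate
        open_coordinate closed_lex_le_map_shift)
  finally show ?thesis .
qed

section \<open>Bases with a reflected tail\<close>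

text \<open>
  The bases in question: \<open>q\<close> lies in \<^const>\<open>V_bases\<close>, and \<open>\<alpha>\<close> is
  \<open>(\<alpha>\<^sub>1\<dots>\<alpha>\<^sub>k \<alpha>\<^sub>1'\<dots>\<alpha>\<^sub>k')\<^sup>\<infinity>\<close>, where the prime denotes reflection.
\<close>

locale reflected_base = base +
  fixes k :: nat
  assumes k_pos: "0 < k"
    and reflect_alpha_le: "\<And>n. 0 < n \<Longrightarrow> lex_le (reflect A (shift_seq n (alpha q))) (alpha q)"
    and reflect_shift_alpha: "reflect A (shift_seq k (alpha q)) = alpha q"
begin

lemma shift_alpha: "shift_seq k (alpha q) = reflect A (alpha q)"
  using reflect_reflect[OF digits_shift[OF digits_alpha]] reflect_shift_alpha by metis

lemma shift_reflect_alpha: "shift_seq k (reflect A (alpha q)) = alpha q"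
  by (simp add: shift_reflect reflect_shift_alpha)

lemma shift_alpha_period: "shift_seq (k + k) (alpha q) = alpha q"
  using shift_reflect_alpha unfolding shift_alpha[symmetric] by simp

lemma alpha_not_const: "alpha q \<noteq> (\<lambda>_. A)"
proof
  assume "alpha q = (\<lambda>_. A)"
  then have "alpha q = (\<lambda>_. 0)"
    using reflect_shift_alpha by (simp add: shift_seq_def reflect_def)
  with alpha_0 A_pos show False by simp
qed

text \<open>
  If \<open>\<alpha>\<^sub>k = 0\<close>, the condition on the tail after \<open>\<alpha>\<^sub>k\<^sub>-\<^sub>1\<close> reads \<open>A \<alpha> \<le> \<alpha>\<close>, and \<open>\<alpha>\<close> would be constant.
\<close>

lemma alpha_last_pos: "0 < alpha q (k - 1)"
proof (rule ccontr)
  assume "\<not> 0 < alpha q (k - 1)"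
  then have last: "alpha q (k - 1) = 0" by simp
  have "k - 1 \<noteq> 0"
  proof
    assume "k - 1 = 0"
    from last[unfolded this] alpha_0 A_pos show False by simp
  qed
  then have le: "lex_le (reflect A (shift_seq (k - 1) (alpha q))) (alpha q)"
    by (intro reflect_alpha_le) simp
  have "lex_le (shift_seq 1 (reflect A (shift_seq (k - 1) (alpha q)))) (shift_seq 1 (alpha q))"
    using le by (rule lex_le_shift_of_prefix) (simp add: reflect_def shift_seq_def last[simplified] alpha_0)
  moreover have "shift_seq 1 (reflect A (shift_seq (k - 1) (alpha q))) = alpha q"
    using k_pos reflect_shift_alpha by (simp add: shift_reflect)
  ultimately have "shift_seq 1 (alpha q) = alpha q"
    using shift_alpha_lex_le[of 1] by (simp add: lex_le_antisym)
  then have "alpha q (Suc n) = alpha q n" for n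
    by (metis plus_1_eq_Suc shift_seq_def)
  then have "alpha q n = A" for n
    by (induction n) (auto simp: alpha_0)
  with last A_pos show False by simp
qed

text \<open>
  A sequence bounded by \<open>\<alpha>\<close> that starts with \<open>\<alpha>\<^sub>1\<dots>\<alpha>\<^sub>k\<close> continues by at most the reflection of \<open>\<alpha>\<close>. As
  \<open>\<alpha>\<^sub>k > 0\<close>, it also continues by at least this. This rigidity is what makes the base special.
\<close>

lemma V_seqs_tail_eq_alpha:
  assumes c: "c \<in> V_seqs" and n: "c n < A" and prefix: "\<And>i. i < k \<Longrightarrow> c (Suc n + i) = alpha q i"
  shows "shift_seq (Suc n) c = alpha q"
proof -
  let ?t = "shift_seq (Suc n) c"
  have t: "?t i = alpha q i" if "i < k" for i
    using prefix[OF that] by (simp add: shift_seq_def)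
  have "lex_le ?t (alpha q)" using c n by (simp add: V_seqs_def)
  then have 1: "lex_le (shift_seq k ?t) (shift_seq k (alpha q))"
    using t by (rule lex_le_shift_of_prefix)
  have "0 < c (n + k)"
    using prefix[of "k - 1"] k_pos alpha_last_pos by simp
  then have "lex_le (reflect A (shift_seq k ?t)) (alpha q)"
    using c by (simp add: V_seqs_def)
  then have "lex_le (reflect A (shift_seq k ?t)) (reflect A (shift_seq k (alpha q)))"
    by (simp add: reflect_shift_alpha)
  then have "lex_le (shift_seq k (alpha q)) (shift_seq k ?t)"
    using V_seqs_digits[OF c] by (simp add: lex_le_reflect_iff digits_shift digits_alpha)
  with 1 have eq: "shift_seq k ?t = shift_seq k (alpha q)" by (rule lex_le_antisym)
  show ?thesis
  proof
    fix i
    show "?t i = alpha q i"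
    proof (cases "i < k")
      case False
      then show ?thesis using fun_cong[OF eq, of "i - k"] by (simp add: shift_seq_def)
    qed (rule t)
  qed
qed

text \<open>
  By rigidity, a sequence in \<^term>\<open>V_seqs\<close> fails to be in \<^term>\<open>U_seqs\<close> iff it contains the word
  \<open>\<alpha>\<^sub>1\<dots>\<alpha>\<^sub>k\<close> after a digit below \<open>A\<close>, or the reflection of this word after a positive digit. As these
  words are finite, \<^term>\<open>U_seqs\<close> is closed as well.
\<close>

lemma U_seqs_eq:
  "U_seqs = {c \<in> V_seqs. \<forall>n. (c n < A \<longrightarrow> (\<exists>i\<in>{..<k}. c (Suc n + i) \<noteq> alpha q i)) \<and>
     (0 < c n \<longrightarrow> (\<exists>i\<in>{..<k}. A - c (Suc n + i) \<noteq> alpha q i))}"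
proof -
  have up: "shift_seq (Suc n) c = alpha q \<longleftrightarrow> (\<forall>i\<in>{..<k}. c (Suc n + i) = alpha q i)"
    if "c \<in> V_seqs" "c n < A" for c n
    using V_seqs_tail_eq_alpha[OF that] by (metis lessThan_iff shift_seq_def)
  have down: "reflect A (shift_seq (Suc n) c) = alpha q \<longleftrightarrow> (\<forall>i\<in>{..<k}. A - c (Suc n + i) = alpha q i)"
    if "c \<in> V_seqs" "0 < c n" for c n
  proof -
    have "reflect A c n < A" using that A_pos by (simp add: reflect_def)
    from up[OF reflect_V_seqs[OF that(1)] this] show ?thesis
      by (simp add: shift_reflect) (simp add: reflect_def)
  qed
  show ?thesis unfolding U_seqs_def using up down by blast
qed

lemma closed_U_seqs: "closed U_seqs"
  unfolding U_seqs_eq Collect_conj_eq Collect_mem_eq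
  by (intro closed_Int closed_V_seqs closed_Collect_all closed_Collect_conj closed_Collect_imp
      open_coordinate closed_ex_coordinates) simp_all

lemma closed_U_set: "closed (U_set q)" and closed_V_set: "closed (V_set q)"
proof -
  have V: "V_seqs \<subseteq> {c. digits A c}" using V_seqs_digits by blast
  then show "closed (V_set q)"
    unfolding V_set_eq[OF alpha_not_const] by (intro compact_imp_closed compact_dval_image closed_V_seqs)
  have "U_seqs \<subseteq> {c. digits A c}" using V unfolding U_seqs_def by blast
  then show "closed (U_set q)"
    unfolding U_set_eq by (intro compact_imp_closed compact_dval_image closed_U_seqs)
qed

lemma V_minus_U_eq: "V_set q - U_set q = dval q ` (V_seqs - U_seqs)"
proof -
  have "U_seqs \<subseteq> V_seqs" by (auto simp: U_seqs_def)
  then show ?thesis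
    unfolding V_set_eq[OF alpha_not_const] U_set_eq
    using inj_on_image_set_diff[OF inj_on_dval_V_seqs[OF alpha_not_const], of V_seqs U_seqs] by simp
qed

lemma alpha_period_digit: "alpha q (k + k - 1) < A"
proof -
  have "shift_seq k (alpha q) (k - 1) = A - alpha q (k - 1)"
    by (simp add: shift_alpha reflect_def)
  then have "alpha q (k + k - 1) = A - alpha q (k - 1)"
    using k_pos by (simp add: shift_seq_def)
  then show ?thesis using alpha_last_pos A_pos by simp
qed

text \<open>
  A tail equal to the reflection of \<open>\<alpha>\<close> turns into \<open>\<alpha>\<close> after another \<open>k\<close> digits, so both ways of
  leaving \<^term>\<open>U_seqs\<close> produce the tail \<open>\<alpha>\<close>.
\<close>

lemma V_minus_U_tail:
  assumes c: "c \<in> V_seqs - U_seqs"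
  obtains n where "c n < A" "shift_seq (Suc n) c = alpha q"
proof -
  from c obtain n where "c n < A \<and> shift_seq (Suc n) c = alpha q \<or>
      0 < c n \<and> reflect A (shift_seq (Suc n) c) = alpha q"
    by (auto simp: U_seqs_def)
  then show ?thesis
  proof
    assume "0 < c n \<and> reflect A (shift_seq (Suc n) c) = alpha q"
    then have eq: "shift_seq (Suc n) c = reflect A (alpha q)"
      using reflect_reflect[OF digits_shift[OF V_seqs_digits]] c by (metis DiffD1)
    have "c (Suc n + (k - 1)) = A - alpha q (k - 1)"
      using fun_cong[OF eq, of "k - 1"] by (simp add: shift_seq_def reflect_def)
    then have "c (n + k) < A" using alpha_last_pos A_pos k_pos by simp
    moreover have "shift_seq (Suc (n + k)) c = alpha q"
      using arg_cong[OF eq, of "shift_seq k"] by (simp add: shift_reflect_alpha)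
    ultimately show ?thesis by (rule that)
  qed (use that in blast)
qed

lemma not_U_seqs_of_tail:
  assumes c: "shift_seq n c = alpha q"
  shows "c \<notin> U_seqs"
proof
  assume U: "c \<in> U_seqs"
  have "c (n + (k + k - 1)) < A"
    using alpha_period_digit fun_cong[OF c, of "k + k - 1"] by (simp add: shift_seq_def)
  moreover have "shift_seq (Suc (n + (k + k - 1))) c = alpha q"
    using arg_cong[OF c, of "shift_seq (k + k)"] k_pos by (simp add: shift_alpha_period)
  ultimately show False using U unfolding U_seqs_def by blast
qed

section \<open>Isolation and density of the difference set\<close>

text \<open>
  By rigidity, a sequence in \<^term>\<open>V_seqs - U_seqs\<close> is determined, among all sequences in
  \<^term>\<open>V_seqs\<close>, by a finite prefix. The sequences without this prefix form a compact set.
\<close>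

lemma discrete_V_minus_U: "discrete (V_set q - U_set q)"
proof (rule discreteI)
  fix x assume x: "x \<in> V_set q - U_set q"
  then obtain a where a: "a \<in> V_seqs - U_seqs" "x = dval q a" unfolding V_minus_U_eq by blast
  then obtain n where n: "a n < A" "shift_seq (Suc n) a = alpha q" using V_minus_U_tail by blast
  define C where "C = V_seqs \<inter> {c. \<exists>i\<in>{..<Suc n + k}. c i \<noteq> a i}"
  have C: "V_seqs - C \<subseteq> {a}"
  proof
    fix c assume c: "c \<in> V_seqs - C"
    then have same: "c i = a i" if "i < Suc n + k" for i using that by (auto simp: C_def)
    have tail: "a (Suc n + i) = alpha q i" for i
      using fun_cong[OF n(2), of i] by (simp add: shift_seq_def)
    have "shift_seq (Suc n) c = alpha q"
    proof (rule V_seqs_tail_eq_alpha)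
      show "c (Suc n + i) = alpha q i" if "i < k" for i
        using same[of "Suc n + i"] tail[of i] that by simp
    qed (use c n(1) same[of n] in \<open>auto simp: C_def\<close>)
    have "c i = a i" for i
    proof (cases "i < Suc n + k")
      case False
      then show ?thesis
        using fun_cong[OF \<open>shift_seq (Suc n) c = alpha q\<close>, of "i - Suc n"] tail[of "i - Suc n"]
        by (simp add: shift_seq_def)
    qed (rule same)
    then show "c \<in> {a}" by auto
  qed
  have "closed C" unfolding C_def by (intro closed_Int closed_V_seqs closed_ex_coordinates) simp
  moreover have "C \<subseteq> {c. digits A c}" using V_seqs_digits by (auto simp: C_def)
  ultimately have "open (- dval q ` C)"
    by (intro open_Compl compact_imp_closed compact_dval_image)
  moreover have "x \<notin> dval q ` C"
    using inj_on_dval_V_seqs[OF alpha_not_const] a by (auto simp: C_def inj_on_def)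
  then have "- dval q ` C \<inter> (V_set q - U_set q) = {x}"
    using x C a unfolding V_minus_U_eq by blast
  ultimately show "x isolated_in (V_set q - U_set q)"
    using x by (intro isolated_inI)
qed

end

lemma lex_le_squeeze:
  assumes "lex_le x y" "lex_le y z" "\<And>i. i < N \<Longrightarrow> x i = z i"
  shows "i < N \<Longrightarrow> y i = z i"
proof (induction i rule: less_induct)
  case (less i)
  then have eq: "y j = z j" "x j = y j" if "j < i" for j using that assms(3)[of j] by auto
  have "y i \<le> z i" using assms(2) eq(1) by (rule lex_le_prefix_le)
  moreover have "x i \<le> y i" using assms(1) eq(2) by (rule lex_le_prefix_le)
  ultimately show ?case using assms(3)[OF less.prems] by simp
qed

lemma lex_le_replace_tail:
  assumes "lex_le c b" "\<And>i. i < l \<Longrightarrow> d i = c i"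
    and "(\<And>i. i < l \<Longrightarrow> c i = b i) \<Longrightarrow> lex_le (shift_seq l d) (shift_seq l b)"
  shows "lex_le d b"
proof (rule lex_leI)
  fix i
  assume eq: "\<And>j. j < i \<Longrightarrow> d j = b j"
  show "d i \<le> b i"
  proof (cases "i < l")
    case True
    have "c j = b j" if "j < i" for j
      using that eq[OF that] assms(2)[of j] True by simp
    with assms(1) have "c i \<le> b i" by (rule lex_le_prefix_le)
    then show ?thesis using assms(2)[OF True] by simp
  next
    case False
    then have "c j = b j" if "j < l" for j
      using that assms(2)[OF that] eq[of j] by simp
    then have "lex_le (shift_seq l d) (shift_seq l b)" by (rule assms(3))
    moreover have "shift_seq l d j = shift_seq l b j" if "j < i - l" for j
      using that eq[of "l + j"] by (simp add: shift_seq_def)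
    ultimately have "shift_seq l d (i - l) \<le> shift_seq l b (i - l)"
      by (rule lex_le_prefix_le)
    then show ?thesis using False by (simp add: shift_seq_def)
  qed
qed

lemma countable_tail_eq:
  fixes t :: dseq
  shows "countable {c. \<exists>n. shift_seq n c = t}"
proof (rule countable_subset)
  show "{c. \<exists>n. shift_seq n c = t} \<subseteq>
    range (\<lambda>w i. if i < length w then w ! i else t (i - length w))"
  proof
    fix c assume "c \<in> {c. \<exists>n. shift_seq n c = t}"
    then obtain n where n: "shift_seq n c = t" by blast
    have "c = (\<lambda>i. if i < length (map c [0..<n]) then map c [0..<n] ! i else t (i - length (map c [0..<n])))"
      unfolding n[symmetric] by (auto simp: shift_seq_def)
    then show "c \<in> range (\<lambda>w i. if i < length w then w ! i else t (i - length w))" by (rule range_eqI)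
  qed
qed simp

lemma eqpoll_UNIV_nat: "countable S \<Longrightarrow> infinite S \<Longrightarrow> S \<approx> (UNIV :: nat set)"
  unfolding eqpoll_def using to_nat_on_infinite by blast

context reflected_base
begin

lemma lex_le_reflect_alpha_shift:
  assumes "0 < n"
  shows "lex_le (reflect A (alpha q)) (shift_seq n (alpha q))"
  using lex_le_reflect_iff[of A "alpha q" "reflect A (shift_seq n (alpha q))"] reflect_alpha_le[OF assms]
  by (simp add: digits_alpha reflect_reflect digits_shift)

lemma reflect_alpha_lex_le: "lex_le (reflect A (alpha q)) (alpha q)"
  using lex_le_trans[OF lex_le_reflect_alpha_shift[OF k_pos] shift_alpha_lex_le] .

text \<open>
  A sequence \<open>c\<close> in \<^term>\<open>V_seqs\<close> is approximated by sequences \<open>c\<^sub>1\<dots>c\<^sub>j \<alpha>\<close>. An upper bound for a tail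
  \<open>c\<^sub>n\<^sub>+\<^sub>1\<dots>c\<^sub>j \<alpha>\<close> of such a sequence can fail only if \<open>c\<^sub>n\<^sub>+\<^sub>1\<dots>c\<^sub>j\<close> is a prefix of \<open>\<alpha>\<close>. For this reason, if some
  tail of \<open>c\<^sub>1\<dots>c\<^sub>m\<close> that follows a digit below \<open>A\<close> is a prefix of \<open>\<alpha>\<close>, the longest such tail is continued
  to \<open>\<alpha>\<close>; otherwise \<open>j = m\<close>.
\<close>

lemma V_seqs_approximation:
  assumes c: "c \<in> V_seqs"
  obtains b where "b \<in> V_seqs - U_seqs" "\<And>i. i < m \<Longrightarrow> b i = c i"
proof -
  define Q where "Q j \<longleftrightarrow> j = m \<or> 0 < j \<and> j \<le> m \<and> c (j - 1) < A \<and> (\<forall>i<m - j. c (j + i) = alpha q i)" for j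
  define j where "j = (LEAST j. Q j)"
  have "Q m" by (simp add: Q_def)
  then have j: "Q j" and least: "\<And>i. i < j \<Longrightarrow> \<not> Q i"
    unfolding j_def by (rule LeastI) (rule not_less_Least)
  have "j \<le> m" using j by (auto simp: Q_def)
  have word: "c (j + i) = alpha q i" if "i < m - j" for i
    using that j by (auto simp: Q_def)
  define b where "b i = (if i < j then c i else alpha q (i - j))" for i
  have tail: "shift_seq n b = shift_seq (n - j) (alpha q)" if "j \<le> n" for n
    using that by (auto simp: shift_seq_def b_def)
  have dig: "digits A b"
    using V_seqs_digits[OF c] digits_alpha by (simp add: b_def digits_def)
  have up: "lex_le (shift_seq (Suc n) b) (alpha q)" if n: "b n < A" for n
  proof (cases "Suc n < j")
    case True
    let ?l = "j - Suc n"
    let ?d = "shift_seq (Suc n) c"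
    have "c n < A" using n True by (simp add: b_def)
    then have d: "lex_le ?d (alpha q)" using c by (simp add: V_seqs_def)
    moreover
    have in_word: "Suc n + i < j" if "i < ?l" for i
      using that by linarith
    then have "shift_seq (Suc n) b i = ?d i" if "i < ?l" for i
      using that by (simp add: b_def shift_seq_def)
    moreover have "lex_le (shift_seq ?l (shift_seq (Suc n) b)) (shift_seq ?l (alpha q))"
      if pre: "\<And>i. i < ?l \<Longrightarrow> ?d i = alpha q i"
    proof -
      have *: "lex_le (shift_seq ?l ?d) (shift_seq ?l (alpha q))"
        using d pre by (rule lex_le_shift_of_prefix)
      have **: "shift_seq ?l (alpha q) i = alpha q i" if "i < m - j" for i
        using * shift_alpha_lex_le _ that
      proof (rule lex_le_squeeze)
        show "shift_seq ?l ?d i = alpha q i" if "i < m - j" for i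
          using word[OF that] True by (simp add: shift_seq_def)
      qed
      have "c (Suc n + i) = alpha q i" if "i < m - Suc n" for i
      proof (cases "i < ?l")
        case True
        then show ?thesis using pre[of i] by (simp add: shift_seq_def)
      next
        case False
        then have i: "i - ?l < m - j" "?l + (i - ?l) = i" "j + (i - ?l) = Suc n + i"
          using that \<open>Suc n < j\<close> by auto
        show ?thesis
          using word[OF i(1), unfolded i(3)] **[OF i(1), unfolded shift_seq_def i(2)] by simp
      qed
      then have "Q (Suc n)" using True \<open>j \<le> m\<close> \<open>c n < A\<close> by (simp add: Q_def)
      with least True show ?thesis by blast
    qed
    ultimately show ?thesis by (rule lex_le_replace_tail)
  next
    case False
    then show ?thesis using tail[of "Suc n"] shift_alpha_lex_le by simp
  qed
  have down: "lex_le (reflect A (shift_seq (Suc n) b)) (alpha q)" if n: "0 < b n" for n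
  proof (cases "Suc n < j")
    case True
    let ?l = "j - Suc n"
    have "lex_le (reflect A (shift_seq (Suc n) c)) (alpha q)"
      using c n True by (simp add: V_seqs_def b_def)
    moreover
    have in_word: "Suc n + i < j" if "i < ?l" for i
      using that by linarith
    then have "reflect A (shift_seq (Suc n) b) i = reflect A (shift_seq (Suc n) c) i" if "i < ?l" for i
      using that by (simp add: b_def shift_seq_def reflect_def)
    moreover have "shift_seq ?l (reflect A (shift_seq (Suc n) b)) = reflect A (alpha q)"
      using True tail[of j] by (simp add: shift_reflect)
    then have "lex_le (shift_seq ?l (reflect A (shift_seq (Suc n) b))) (shift_seq ?l (alpha q))"
      using lex_le_reflect_alpha_shift[of ?l] True by simp
    ultimately show ?thesis by (rule lex_le_replace_tail)
  next
    case False
    then show ?thesis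
      using tail[of "Suc n"] reflect_alpha_le[of "Suc n - j"] reflect_alpha_lex_le
      by (cases "Suc n = j") auto
  qed
  have "b \<in> V_seqs" using dig up down by (simp add: V_seqs_def)
  moreover have "b \<notin> U_seqs" using tail[of j] by (intro not_U_seqs_of_tail[of j]) simp
  moreover have "b i = c i" if "i < m" for i
    using that word[of "i - j"] by (auto simp: b_def)
  ultimately show ?thesis using that[of b] by blast
qed

lemma V_set_subset_closure: "V_set q \<subseteq> closure (V_set q - U_set q)"
proof
  fix x assume "x \<in> V_set q"
  then obtain c where c: "c \<in> V_seqs" "x = dval q c"
    unfolding V_set_eq[OF alpha_not_const] by blast
  show "x \<in> closure (V_set q - U_set q)"
    unfolding closure_approachable
  proof (intro allI impI)
    fix e :: real
    assume "0 < e"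
    define B where "B = real A / (q - 1)"
    obtain m where m: "B / e < q ^ m" using real_arch_pow[OF q_gt_1] by blast
    obtain b where b: "b \<in> V_seqs - U_seqs" "\<And>i. i < m \<Longrightarrow> b i = c i"
      using V_seqs_approximation[OF c(1)] by blast
    have dig: "digits A b" "digits A c" using b c V_seqs_digits by auto
    have "(\<Sum>i<m. real (b i) / q ^ Suc i) = (\<Sum>i<m. real (c i) / q ^ Suc i)"
      using b(2) by (intro sum.cong) auto
    then have "dval q b - dval q c = (dval q (shift_seq m b) - dval q (shift_seq m c)) / q ^ m"
      using dval_split[OF dig(1), of m] dval_split[OF dig(2), of m] by (simp add: diff_divide_distrib)
    moreover have "\<bar>dval q (shift_seq m b) - dval q (shift_seq m c)\<bar> \<le> B"
      using dval_nonneg[OF digits_shift[OF dig(1)], of m] dval_le[OF digits_shift[OF dig(1)], of m]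
        dval_nonneg[OF digits_shift[OF dig(2)], of m] dval_le[OF digits_shift[OF dig(2)], of m]
      unfolding B_def by linarith
    ultimately have "dist (dval q b) x \<le> B / q ^ m"
      using q_gt_1 c(2) by (simp add: dist_real_def divide_right_mono)
    also have "\<dots> < e" using m \<open>0 < e\<close> q_gt_1 by (simp add: field_simps)
    finally have "dist (dval q b) x < e" .
    moreover have "dval q b \<in> V_set q - U_set q" using b(1) V_minus_U_eq by blast
    ultimately show "\<exists>y\<in>V_set q - U_set q. dist y x < e" by blast
  qed
qed

lemma countable_V_minus_U: "countable (V_set q - U_set q)"
proof -
  have "V_seqs - U_seqs \<subseteq> {c. \<exists>n. shift_seq n c = alpha q}"
    using V_minus_U_tail by blast
  then have "countable (V_seqs - U_seqs)"
    using countable_tail_eq countable_subset by blast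
  then show ?thesis unfolding V_minus_U_eq by (rule countable_image)
qed

lemma infinite_V_minus_U: "infinite (V_set q - U_set q)"
proof
  \<comment> \<open>A finite set is closed, so by density it would exhaust \<open>V_set\<close>; but 0 has only one expansion.\<close>
  assume "finite (V_set q - U_set q)"
  then have "V_set q \<subseteq> V_set q - U_set q"
    using V_set_subset_closure by (simp add: closure_closed finite_imp_closed)
  moreover have "0 \<in> V_set q"
    unfolding V_set_eq[OF alpha_not_const] using zero_V_seqs by (rule rev_image_eqI) simp
  moreover have "\<exists>!c. is_expansion q 0 c"
    unfolding is_expansion_iff by (rule ex1I[of _ "\<lambda>_. 0"]) (auto simp: dval_eq_0_iff digits_def)
  then have "0 \<in> U_set q" by (simp add: U_set_def)
  ultimately show False by blast
qed

section \<open>Expansions of elements of the difference set\<close>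

text \<open>
  If an expansion first exceeds \<open>a\<close> in some digit, the tail of \<open>a\<close> after this digit has value at most 1,
  so the other expansion continues with \<open>0\<^sup>\<infinity>\<close>; symmetrically, an expansion that first falls below \<open>a\<close>
  continues with \<open>A\<^sup>\<infinity>\<close>.
\<close>

lemma countable_expansions:
  assumes a: "a \<in> V_seqs"
  shows "countable {c. is_expansion q (dval q a) c}"
proof -
  have "{c. is_expansion q (dval q a) c} \<subseteq>
    insert a ({c. \<exists>n. shift_seq n c = (\<lambda>_. 0)} \<union> {c. \<exists>n. shift_seq n c = (\<lambda>_. A)})"
  proof
    fix d assume "d \<in> {c. is_expansion q (dval q a) c}"
    then have d: "digits A d" "dval q d = dval q a" by (auto simp: is_expansion_iff)
    show "d \<in> insert a ({c. \<exists>n. shift_seq n c = (\<lambda>_. 0)} \<union> {c. \<exists>n. shift_seq n c = (\<lambda>_. A)})"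
    proof (cases "d = a")
      case False
      then have "less_fun d a \<or> less_fun a d" using less_fun_or_ge[of a d] by (auto simp: lex_le_def)
      then obtain n where n: "a n \<noteq> d n" "\<And>j. j < n \<Longrightarrow> a j = d j"
        by (auto elim!: less_funE) (metis less_irrefl)+
      have digS: "digits A (shift_seq (Suc n) d)" using d(1) by (rule digits_shift)
      have eq: "real (a n) + dval q (shift_seq (Suc n) a) = real (d n) + dval q (shift_seq (Suc n) d)"
        using dval_eq_first[OF V_seqs_digits[OF a] d(1)] d(2) n(2) by simp
      consider "a n < d n" | "d n < a n" using n(1) by linarith
      then have "shift_seq (Suc n) d = (\<lambda>_. 0) \<or> shift_seq (Suc n) d = (\<lambda>_. A)"
      proof cases
        case 1
        then have "a n < A" using d(1) by (meson digits_def less_le_trans)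
        from dval_shift_V_seqs(1)[OF a this] 1 eq dval_nonneg[OF digS]
        have "dval q (shift_seq (Suc n) d) = 0" by linarith
        then show ?thesis using dval_eq_0_iff[OF digS] by simp
      next
        case 2
        then have "0 < a n" by simp
        from dval_reflect_shift_V_seqs(1)[OF a this]
        have "real A / (q - 1) - dval q (shift_seq (Suc n) a) \<le> 1"
          using V_seqs_digits[OF a] by (simp add: dval_reflect digits_shift)
        with 2 eq dval_nonneg[OF digits_reflect, of "shift_seq (Suc n) d"]
        have "dval q (reflect A (shift_seq (Suc n) d)) = 0"
          by (simp add: dval_reflect digS)
        then have "reflect A (shift_seq (Suc n) d) = (\<lambda>_. 0)" using dval_eq_0_iff by simp
        then have "A - d (Suc n + i) = 0" for i by (auto simp: reflect_def shift_seq_def fun_eq_iff)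
        moreover have "d (Suc n + i) \<le> A" for i using d(1) by (simp add: digits_def)
        ultimately have "d (Suc n + i) = A" for i by (metis diff_is_0_eq le_antisym)
        then have "shift_seq (Suc n) d = (\<lambda>_. A)" by (simp add: shift_seq_def)
        then show ?thesis ..
      qed
      then show ?thesis by blast
    qed simp
  qed
  then show ?thesis
    by (rule countable_subset) (intro countable_insert countable_Un countable_tail_eq)
qed

text \<open>
  The finite sequence \<open>c\<^sub>1\<dots>c\<^sub>n (c\<^sub>n\<^sub>+\<^sub>1 + 1) 0\<^sup>\<infinity>\<close>. If the tail of \<open>c\<close> after \<open>c\<^sub>n\<^sub>+\<^sub>1\<close> has value 1, it has the
  same value as \<open>c\<close>.
\<close>

definition raise_digit :: "dseq \<Rightarrow> nat \<Rightarrow> dseq" where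
  "raise_digit c n i = (if i < n then c i else if i = n then Suc (c n) else 0)"

lemma shift_raise_digit: "n < m \<Longrightarrow> shift_seq m (raise_digit c n) = (\<lambda>_. 0)"
  by (auto simp: shift_seq_def raise_digit_def)

lemma digits_raise_digit: "digits A c \<Longrightarrow> c n < A \<Longrightarrow> digits A (raise_digit c n)"
  by (simp add: digits_def raise_digit_def)

lemma finite_raise_digit: "finite_seq (raise_digit c n)"
  using shift_raise_digit[OF lessI, of n c] finite_seq_shift_iff[of "Suc n" "raise_digit c n"]
  by (simp add: finite_seq_def)

lemma raise_digit_expansion:
  assumes "digits A c" "c n < A" "shift_seq (Suc n) c = alpha q"
  shows "is_expansion q (dval q c) (raise_digit c n)"
proof -
  have "dval q (raise_digit c n) - dval q c = 0"
    using dval_diff_first[OF digits_raise_digit[OF assms(1,2)] assms(1), of n]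
    by (simp add: shift_raise_digit assms(3) dval_alpha raise_digit_def)
  then show ?thesis using assms by (simp add: is_expansion_iff digits_raise_digit)
qed

lemma infinite_expansions:
  assumes a: "a \<in> V_seqs - U_seqs"
  shows "infinite {c. is_expansion q (dval q a) c}"
proof -
  obtain n where n: "a n < A" "shift_seq (Suc n) a = alpha q" using a V_minus_U_tail by blast
  have good: "a (n + j * (k + k)) < A \<and> shift_seq (Suc (n + j * (k + k))) a = alpha q" for j
  proof (induction j)
    case (Suc j)
    let ?n = "n + j * (k + k)"
    have s: "shift_seq (Suc ?n) a = alpha q" using Suc by blast
    have "a (Suc ?n + (k + k - 1)) < A"
      using fun_cong[OF s, of "k + k - 1"] alpha_period_digit by (simp add: shift_seq_def)
    moreover have "shift_seq (Suc ?n + (k + k)) a = alpha q"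
      using arg_cong[OF s, of "shift_seq (k + k)"] by (simp add: shift_alpha_period)
    moreover have "Suc ?n + (k + k - 1) = n + Suc j * (k + k)"
      "Suc ?n + (k + k) = Suc (n + Suc j * (k + k))" using k_pos by auto
    ultimately show ?case by metis
  qed (use n in simp)
  have "inj (\<lambda>j. raise_digit a (n + j * (k + k)))"
  proof (rule linorder_injI)
    fix i j :: nat
    assume "i < j"
    then have "n + i * (k + k) < n + j * (k + k)" using k_pos by simp
    then have "raise_digit a (n + i * (k + k)) (n + j * (k + k)) = 0" by (simp add: raise_digit_def)
    moreover have "raise_digit a (n + j * (k + k)) (n + j * (k + k)) \<noteq> 0" by (simp add: raise_digit_def)
    ultimately show "raise_digit a (n + i * (k + k)) \<noteq> raise_digit a (n + j * (k + k))" by metis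
  qed
  then have "infinite (range (\<lambda>j. raise_digit a (n + j * (k + k))))" by (rule range_inj_infinite)
  moreover have "range (\<lambda>j. raise_digit a (n + j * (k + k))) \<subseteq> {c. is_expansion q (dval q a) c}"
    using good raise_digit_expansion V_seqs_digits a by blast
  ultimately show ?thesis using infinite_super by blast
qed

text \<open>The greedy expansion is obtained from the first tail \<open>\<alpha>\<close> that follows a digit below \<open>A\<close>.\<close>

lemma finite_greedy_expansion:
  assumes a: "a \<in> V_seqs - U_seqs"
  shows "\<exists>c. is_greedy_expansion q (dval q a) c \<and> finite_seq c"
proof -
  define G where "G n \<longleftrightarrow> a n < A \<and> shift_seq (Suc n) a = alpha q" for n
  define n where "n = (LEAST n. G n)"
  have "\<exists>n. G n" using a V_minus_U_tail unfolding G_def by blast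
  then have n: "G n" and least: "\<And>i. i < n \<Longrightarrow> \<not> G i"
    unfolding n_def by (rule LeastI_ex) (rule not_less_Least)
  have aV: "a \<in> V_seqs" and dig: "digits A a" using a V_seqs_digits by auto
  have exp: "is_expansion q (dval q a) (raise_digit a n)"
    using raise_digit_expansion dig n by (simp add: G_def)
  have "lex_le d (raise_digit a n)" if "is_expansion q (dval q a) d" for d
  proof (rule ccontr)
    assume "\<not> lex_le d (raise_digit a n)"
    then obtain j where j: "raise_digit a n j < d j" "\<And>i. i < j \<Longrightarrow> raise_digit a n i = d i"
      unfolding not_lex_le_iff by (auto elim: less_funE)
    have d: "digits A d" "dval q d = dval q a" using that by (auto simp: is_expansion_iff)
    have nonneg: "0 \<le> dval q (shift_seq (Suc j) d)" using d(1) by (intro dval_nonneg digits_shift)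
    show False
    proof (cases "j \<le> n")
      case True
      have "a i = d i" if "i < j" for i
        using j(2)[OF that] that True by (simp add: raise_digit_def)
      then have eq: "real (a j) + dval q (shift_seq (Suc j) a) = real (d j) + dval q (shift_seq (Suc j) d)"
        using dval_eq_first[OF dig d(1)] d(2) by simp
      have less: "a j < d j" using j(1) True by (auto simp: raise_digit_def split: if_splits)
      then have "a j < A" using d(1) by (meson digits_def less_le_trans)
      note val = dval_shift_V_seqs[OF aV this]
      have "1 \<le> dval q (shift_seq (Suc j) a)" using eq less nonneg by linarith
      then have "shift_seq (Suc j) a = alpha q" using val by linarith
      then have "j = n" using least[of j] True \<open>a j < A\<close> by (cases "j < n") (auto simp: G_def)
      then have "a j + 2 \<le> d j" using j(1) by (simp add: raise_digit_def)
      with eq nonneg val(1) show False by linarith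
    next
      case False
      have "real (raise_digit a n j) + dval q (shift_seq (Suc j) (raise_digit a n)) =
          real (d j) + dval q (shift_seq (Suc j) d)"
        using exp d j(2) by (intro dval_eq_first) (auto simp: is_expansion_iff)
      then show False using False j(1) nonneg by (simp add: raise_digit_def shift_raise_digit)
    qed
  qed
  with exp have "is_greedy_expansion q (dval q a) (raise_digit a n)"
    by (simp add: is_greedy_expansion_def)
  then show ?thesis using finite_raise_digit by blast
qed

end

section \<open>Approximation by univoque bases\<close>

lemma less_fun_decrease:
  fixes c c' d d' :: dseq
  assumes "lex_le c d" "\<And>i. i < n \<Longrightarrow> c' i = c i" "c' n < c n" "\<And>i. i \<le> n \<Longrightarrow> d' i = d i"
  shows "less_fun c' d'"
  using assms(1)
proof (cases rule: lex_leE)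
  case 1
  then show ?thesis using assms(2-4) by (intro less_funI exI[of _ n]) auto
next
  case (2 k)
  show ?thesis
  proof (cases "k < n")
    case True
    then show ?thesis using 2 assms(2,4) by (intro less_funI exI[of _ k]) auto
  next
    case False
    then have "c n \<le> d n" using 2 by (cases "k = n") auto
    then show ?thesis using 2 False assms(2-4) by (intro less_funI exI[of _ n]) auto
  qed
qed

context base
begin

lemma univoque_base_of_less_fun:
  assumes c: "digits A c" "dval q c = 1" "infinite_seq c"
    and up: "\<And>n. c n < A \<Longrightarrow> less_fun (shift_seq (Suc n) c) c"
    and down: "\<And>n. 0 < c n \<Longrightarrow> less_fun (reflect A (shift_seq (Suc n) c)) c"
  shows "q \<in> univoque_bases"
proof -
  have lt: "lex_le d c \<and> d \<noteq> c" if "less_fun d c" for d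
    using that less_fun_irrefl by (auto simp: lex_le_def)
  have "d = c" if "digits A d" "dval q d = 1" for d
  proof (rule unique_of_dval_shift_less_1)
    show "dval q (shift_seq (Suc n) c) < 1" if "c n < A" for n
      using dval_shift_less_1(2)[OF c(1,3,2,1) _ that] lt up that by blast
    show "dval q (reflect A (shift_seq (Suc n) c)) < 1" if "0 < c n" for n
    proof -
      have "lex_le (shift_seq (Suc i) (reflect A c)) c" if "reflect A c i < A" for i
      proof -
        have "0 < c i" using that by (cases "c i") (auto simp: reflect_def)
        from lt[OF down[OF this]] show ?thesis by (simp add: shift_reflect)
      qed
      moreover have "reflect A c n < A" using that A_pos by (simp add: reflect_def)
      moreover have "shift_seq (Suc n) (reflect A c) \<noteq> c"
        using lt[OF down[OF that]] by (simp add: shift_reflect)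
      ultimately show ?thesis
        using dval_shift_less_1(2)[OF c(1,3,2) digits_reflect] by (metis shift_reflect)
    qed
  qed (use c that in auto)
  then have "\<exists>!c. is_expansion q 1 c"
    unfolding is_expansion_iff using c(1,2) by blast
  then show ?thesis using q_gt_1 by (simp add: univoque_bases_def)
qed

lemma continuous_on_dval_base:
  assumes "digits A c"
  shows "continuous_on {q..} (\<lambda>s. dval s c)"
proof (rule uniform_limit_theorem)
  show "uniform_limit {q..} (\<lambda>n s. \<Sum>i<n. real (c i) / s ^ Suc i) (\<lambda>s. dval s c) sequentially"
    unfolding dval_def
  proof (rule Weierstrass_m_test)
    show "summable (\<lambda>i. real A / q ^ Suc i)" using bound_sums by (rule sums_summable)
    fix i :: nat and s :: real
    assume s: "s \<in> {q..}"
    have "real (c i) / s ^ Suc i \<le> real A / q ^ Suc i"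
      using s assms q_gt_1 by (intro frac_le power_mono) (auto simp: digits_def)
    then show "norm (real (c i) / s ^ Suc i) \<le> real A / q ^ Suc i"
      using s q_gt_1 by simp
  qed
  show "\<forall>\<^sub>F n in sequentially. continuous_on {q..} (\<lambda>s. \<Sum>i<n. real (c i) / s ^ Suc i)"
    using q_gt_1 by (intro always_eventually allI continuous_intros) auto
qed simp

lemma dval_less_smaller_base:
  assumes c: "digits A c" "0 < c 0" and s: "base s A" "s < q"
  shows "dval q c < dval s c"
proof -
  interpret s: base s A by fact
  let ?d = "\<lambda>i. real (c i) / s ^ Suc i - real (c i) / q ^ Suc i"
  have le: "real (c i) / q ^ Suc i \<le> real (c i) / s ^ Suc i" for i
    using s.q_gt_1 s(2) by (intro frac_le power_mono) auto
  have "real (c 0) / q < real (c 0) / s"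
    using s.q_gt_1 s(2) c(2) by (intro divide_strict_left_mono) auto
  then have "0 < (\<Sum>i. ?d i)"
    using le by (intro suminf_pos2[of _ 0] summable_diff summable_dval s.summable_dval c) simp_all
  also have "(\<Sum>i. ?d i) = dval s c - dval q c"
    unfolding dval_def by (intro suminf_diff[symmetric] summable_dval s.summable_dval c)
  finally show ?thesis by simp
qed

text \<open>
  A prefix \<open>\<alpha>\<^sub>1\<dots>\<alpha>\<^sub>m\<close> none of whose nonempty tails reflects to a prefix of \<open>\<alpha>\<close>. Lowering its last digit
  keeps the reflected tails within the bound given by \<open>\<alpha>\<close>.
\<close>

definition good_prefix :: "nat \<Rightarrow> bool" where
  "good_prefix m \<longleftrightarrow> (\<forall>i<m. \<exists>l<m - i. A - alpha q (i + l) \<noteq> alpha q l)"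

lemma good_prefix_last_pos:
  assumes "good_prefix m" "0 < m"
  shows "0 < alpha q (m - 1)"
proof -
  have "\<exists>l<m - (m - 1). A - alpha q (m - 1 + l) \<noteq> alpha q l"
    using assms unfolding good_prefix_def by (meson diff_less zero_less_one)
  then obtain l where "l < 1" "A - alpha q (m - 1 + l) \<noteq> alpha q l" using assms(2) by auto
  then show ?thesis using alpha_0 by (cases "alpha q (m - 1)") auto
qed

text \<open>
  From a prefix that is not good, take the longest tail that reflects to a prefix of \<open>\<alpha>\<close>, and go on
  until its reflection falls below \<open>\<alpha>\<close>.
\<close>

lemma good_prefix_exists:
  assumes strict: "\<And>n. less_fun (reflect A (shift_seq n (alpha q))) (alpha q)"
  shows "\<exists>m\<ge>N. good_prefix m"
proof (cases "good_prefix N")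
  case False
  define bad where "bad m i \<longleftrightarrow> i < m \<and> (\<forall>l<m - i. A - alpha q (i + l) = alpha q l)" for m i
  have good_iff: "good_prefix m \<longleftrightarrow> (\<forall>i. \<not> bad m i)" for m
    unfolding good_prefix_def bad_def by blast
  define i where "i = (LEAST i. bad N i)"
  have "\<exists>i. bad N i" using False good_iff by blast
  then have i: "bad N i" and least: "\<And>j. j < i \<Longrightarrow> \<not> bad N j"
    unfolding i_def by (rule LeastI_ex) (rule not_less_Least)
  obtain j where "reflect A (shift_seq i (alpha q)) j < alpha q j"
      "\<And>l. l < j \<Longrightarrow> reflect A (shift_seq i (alpha q)) l = alpha q l"
    using less_funE[OF strict[of i]] by blast
  then have j: "A - alpha q (i + j) < alpha q j" "\<And>l. l < j \<Longrightarrow> A - alpha q (i + l) = alpha q l"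
    by (auto simp: reflect_def shift_seq_def)
  have "N - i \<le> j"
  proof (rule ccontr)
    assume "\<not> N - i \<le> j"
    then have "A - alpha q (i + j) = alpha q j" using i by (simp add: bad_def)
    with j(1) show False by simp
  qed
  then have le: "N \<le> Suc (i + j)" by simp
  have le_A: "alpha q l \<le> A" for l using digits_alpha by (simp add: digits_def)
  have "\<not> bad (Suc (i + j)) i'" for i'
  proof
    assume bad: "bad (Suc (i + j)) i'"
    then have eq: "A - alpha q (i' + l) = alpha q l" if "l < Suc (i + j) - i'" for l
      using that by (simp add: bad_def)
    consider "i' < i" | "i' = i" | "i < i'" by linarith
    then show False
    proof cases
      case 1
      then have "bad N i'" using i le eq by (auto simp: bad_def)
      with least 1 show False by blast
    next
      case 2
      then show False using eq[of j] j(1) by simp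
    next
      case 3
      define s where "s = i' - i"
      have i': "i' = i + s" "s \<le> j" using 3 bad by (auto simp: s_def bad_def)
      have "alpha q l = alpha q (s + l)" if "l < j - s" for l
        using eq[of l] j(2)[of "s + l"] that i' le_A[of "i + s + l"] by (simp add: add.assoc)
      moreover have "alpha q (j - s) < alpha q (s + (j - s))"
        using eq[of "j - s"] j(1) i' by simp
      ultimately have "less_fun (alpha q) (shift_seq s (alpha q))"
        by (intro less_funI exI[of _ "j - s"]) (auto simp: shift_seq_def)
      with shift_alpha_lex_le[of s] show False using not_lex_le_iff by blast
    qed
  qed
  with le show ?thesis using good_iff by blast
qed blast

text \<open>
  For periodic \<open>\<alpha>\<close> there are finitely many tails, hence a common bound for the first position in which
  a reflected tail differs from \<open>\<alpha>\<close>.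
\<close>

lemma uniform_reflection_gap:
  assumes strict: "\<And>n. less_fun (reflect A (shift_seq n (alpha q))) (alpha q)"
    and p: "0 < p" "shift_seq p (alpha q) = alpha q"
  obtains L where "\<And>n. \<exists>i<L. A - alpha q (n + i) < alpha q i \<and> (\<forall>j<i. A - alpha q (n + j) = alpha q j)"
proof -
  have "\<exists>i. A - alpha q (n + i) < alpha q i \<and> (\<forall>j<i. A - alpha q (n + j) = alpha q j)" for n
    using strict[of n] unfolding less_fun_def reflect_def shift_seq_def .
  then obtain f where f: "\<And>n. A - alpha q (n + f n) < alpha q (f n) \<and>
      (\<forall>j<f n. A - alpha q (n + j) = alpha q j)"
    by metis
  have mult: "shift_seq (m * p) (alpha q) = alpha q" for m
  proof (induction m)
    case (Suc m)
    have "shift_seq (Suc m * p) (alpha q) = shift_seq (m * p) (shift_seq p (alpha q))" by simp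
    then show ?case using Suc p(2) by simp
  qed simp
  have per: "alpha q (n + i) = alpha q (n mod p + i)" for n i
  proof -
    have "shift_seq (n mod p + i) (shift_seq (n div p * p) (alpha q)) 0 = shift_seq (n mod p + i) (alpha q) 0"
      unfolding mult ..
    moreover have "n div p * p + (n mod p + i) = n + i" by simp
    ultimately show ?thesis unfolding shift_seq_shift_seq by (simp add: shift_seq_def)
  qed
  show ?thesis
  proof (rule that)
    fix n
    have "f (n mod p) \<le> (\<Sum>n<p. f n)" using p(1) by (intro member_le_sum) auto
    then show "\<exists>i<Suc (\<Sum>n<p. f n). A - alpha q (n + i) < alpha q i \<and> (\<forall>j<i. A - alpha q (n + j) = alpha q j)"
      using f[of "n mod p"] per[of n] by (intro exI[of _ "f (n mod p)"]) auto
  qed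
qed

text \<open>
  For good lengths \<open>m < M\<close>, the sequence \<open>\<alpha>\<^sub>1\<dots>\<alpha>\<^sub>M\<^sub>-\<^sub>1(\<alpha>\<^sub>M-1) (\<alpha>\<^sub>1\<dots>\<alpha>\<^sub>m\<^sub>-\<^sub>1(\<alpha>\<^sub>m-1))\<^sup>\<infinity>\<close> approximates \<open>\<alpha>\<close>
  for large \<open>M\<close>. It is used as the expansion of 1 in a univoque base. With a single length it would be purely
  periodic, hence equal to one of its proper tails.
\<close>

definition approximant :: "nat \<Rightarrow> nat \<Rightarrow> dseq" where
  "approximant M m i =
     (if i < M then if i = M - 1 then alpha q i - 1 else alpha q i
      else if (i - M) mod m = m - 1 then alpha q ((i - M) mod m) - 1 else alpha q ((i - M) mod m))"

lemma digits_approximant: "digits A (approximant M m)"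
  using digits_alpha by (auto simp: digits_def approximant_def intro: le_trans[OF diff_le_self])

lemma approximant_prefix: "i < M - 1 \<Longrightarrow> approximant M m i = alpha q i"
  by (simp add: approximant_def)

text \<open>
  Every proper tail of the approximant starts inside a block of length \<open>l\<close> at offset \<open>t\<close>; the next
  block has length \<open>m\<close>.
\<close>

lemma approximant_tail:
  assumes "0 < m" "m < M" "0 < n"
  obtains l t where "t < l" "l = M \<and> 0 < t \<or> l = m"
    "\<And>i. i < l - 1 - t \<Longrightarrow> approximant M m (n + i) = alpha q (t + i)"
    "approximant M m (n + (l - 1 - t)) = alpha q (l - 1) - 1"
    "\<And>i. i < m - 1 \<Longrightarrow> approximant M m (n + (l - t + i)) = alpha q i"
proof (cases "n < M")
  case True
  show ?thesis
  proof (rule that[of n M])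
    show "approximant M m (n + (M - n + i)) = alpha q i" if "i < m - 1" for i
      using that True by (simp add: approximant_def)
  qed (use True assms in \<open>auto simp: approximant_def\<close>)
next
  case False
  define t where "t = (n - M) mod m"
  define d where "d = (n - M) div m"
  have "t < m" using assms by (simp add: t_def)
  have "d * m + t = n - M" by (simp add: t_def d_def)
  then have n: "n = M + (d * m + t)" using False by simp
  have in_block: "approximant M m (n + i) = (if t + i = m - 1 then alpha q (t + i) - 1 else alpha q (t + i))"
    if "t + i < m" for i
  proof -
    have "(d * m + t + i) mod m = t + i"
      using that by (metis add.assoc mod_less mod_mult_self3)
    then show ?thesis
      unfolding n approximant_def by (cases "t + i = m - 1") (simp_all add: add.assoc)
  qed
  have next_block: "approximant M m (n + (m - t + i)) = alpha q i" if "i < m - 1" for i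
  proof -
    have "n + (m - t + i) - M = Suc d * m + i" using \<open>t < m\<close> unfolding n by simp
    then have "(n + (m - t + i) - M) mod m = i mod m" by (simp only: mod_mult_self3)
    then have "(n + (m - t + i) - M) mod m = i" using that by simp
    then show ?thesis using that False by (simp add: approximant_def)
  qed
  show ?thesis
  proof (rule that[of t m])
    show "approximant M m (n + (m - 1 - t)) = alpha q (m - 1) - 1"
      using in_block[of "m - 1 - t"] \<open>t < m\<close> by simp
    show "approximant M m (n + i) = alpha q (t + i)" if "i < m - 1 - t" for i
      using in_block[of i] that by simp
  qed (use \<open>t < m\<close> next_block in auto)
qed

lemma approximant_tail_less:
  assumes m: "good_prefix m" "good_prefix M" "0 < m" "m < M" and n: "0 < n"
  shows "less_fun (shift_seq n (approximant M m)) (approximant M m)"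
proof -
  obtain l t where t: "t < l" "l = M \<and> 0 < t \<or> l = m"
    and block: "\<And>i. i < l - 1 - t \<Longrightarrow> approximant M m (n + i) = alpha q (t + i)"
      "approximant M m (n + (l - 1 - t)) = alpha q (l - 1) - 1"
    using approximant_tail[OF m(3,4) n] by metis
  show ?thesis
  proof (rule less_fun_decrease)
    show "lex_le (shift_seq t (alpha q)) (alpha q)" by (rule shift_alpha_lex_le)
    show "shift_seq n (approximant M m) i = shift_seq t (alpha q) i" if "i < l - 1 - t" for i
      using block(1)[OF that] by (simp add: shift_seq_def)
    have "0 < alpha q (l - 1)" using t m by (intro good_prefix_last_pos) auto
    then show "shift_seq n (approximant M m) (l - 1 - t) < shift_seq t (alpha q) (l - 1 - t)"
      using block(2) t(1) by (simp add: shift_seq_def)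
    show "approximant M m i = alpha q i" if "i \<le> l - 1 - t" for i
      using that t m by (intro approximant_prefix) auto
  qed
qed

text \<open>
  If the first position given by the gap lies before the end of the current block, it decides the
  comparison. Otherwise it is the end of the block, by goodness; lowering the last digit there leads at
  most to equality, and in this case the next block, which starts with \<open>\<alpha>\<^sub>1\<dots>\<alpha>\<^sub>L\<close>, decides it.
\<close>

lemma approximant_reflected_tail_less:
  assumes m: "good_prefix m" "good_prefix M" "L < m - 1" "2 * L < M - 1" "m < M" and n: "0 < n"
    and gap: "\<And>n. \<exists>i<L. A - alpha q (n + i) < alpha q i \<and> (\<forall>j<i. A - alpha q (n + j) = alpha q j)"
  shows "less_fun (reflect A (shift_seq n (approximant M m))) (approximant M m)"
proof -
  have "0 < m" using m by simp
  then obtain l t where t: "t < l" "l = M \<and> 0 < t \<or> l = m"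
    and block: "\<And>i. i < l - 1 - t \<Longrightarrow> approximant M m (n + i) = alpha q (t + i)"
      "approximant M m (n + (l - 1 - t)) = alpha q (l - 1) - 1"
      "\<And>i. i < m - 1 \<Longrightarrow> approximant M m (n + (l - t + i)) = alpha q i"
    using approximant_tail[OF _ m(5) n] by metis
  have good: "good_prefix l" using t m by auto
  let ?r = "reflect A (shift_seq n (approximant M m))"
  define e where "e = l - 1 - t"
  have e: "t + e = l - 1" "l - t = Suc e" using t(1) by (auto simp: e_def)
  have r1: "?r i = A - alpha q (t + i)" if "i < e" for i
    using block(1)[of i] that by (simp add: reflect_def shift_seq_def e_def)
  have r2: "?r e = A - (alpha q (t + e) - 1)"
    using block(2)[folded e_def] unfolding e(1) by (simp add: reflect_def shift_seq_def)
  have r3: "?r (Suc e + i) = A - alpha q i" if "i < m - 1" for i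
    using block(3)[OF that] unfolding e(2) by (simp add: reflect_def shift_seq_def)
  have pos: "0 < alpha q (t + e)"
    using good t(1) unfolding e(1) by (intro good_prefix_last_pos) auto
  have le_A: "alpha q i \<le> A" for i using digits_alpha by (simp add: digits_def)
  obtain i where i: "i < L" "A - alpha q (t + i) < alpha q i" "\<And>j. j < i \<Longrightarrow> A - alpha q (t + j) = alpha q j"
    using gap[of t] by blast
  have prefix: "approximant M m j = alpha q j" if "j < 2 * L" for j
    using that m(4) by (intro approximant_prefix) simp
  obtain j where j: "j < Suc e" "A - alpha q (t + j) \<noteq> alpha q j"
    using good t(1) unfolding good_prefix_def e(2)[symmetric] by blast
  have "i \<le> e"
  proof (rule ccontr)
    assume "\<not> i \<le> e"
    with i(3)[of j] j show False by simp
  qed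
  consider "i < e" | "i = e" "?r e < alpha q e" | "i = e" "?r e = alpha q e"
    using \<open>i \<le> e\<close> i(2) r2 pos le_A[of "t + e"] by fastforce
  then show ?thesis
  proof cases
    case 1
    then show ?thesis
      using i r1 prefix by (intro less_funI exI[of _ i]) auto
  next
    case 2
    then show ?thesis
      using i r1 prefix by (intro less_funI exI[of _ e]) auto
  next
    case 3
    obtain i' where i': "i' < L" "A - alpha q (Suc e + i') < alpha q i'"
      "\<And>j. j < i' \<Longrightarrow> A - alpha q (Suc e + j) = alpha q j"
      using gap[of "Suc e"] by blast
    have small: "Suc e + i' < 2 * L" "i' < m - 1" using 3 i(1) i'(1) m(3) by auto
    have "?r (Suc e + i') < approximant M m (Suc e + i')"
      using r3[OF small(2)] prefix[OF small(1)] i'(2) le_A[of i'] le_A[of "Suc e + i'"] by linarith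
    moreover have "?r j = approximant M m j" if "j < Suc e + i'" for j
    proof -
      consider "j < e" | "j = e" | "Suc e \<le> j" by linarith
      then have "?r j = alpha q j"
      proof cases
        case 3
        define h where "h = j - Suc e"
        have h: "j = Suc e + h" "h < i'" using 3 that by (auto simp: h_def)
        then show ?thesis
          using r3[of h] small(2) i'(3)[OF h(2)] le_A[of "Suc e + h"] by simp
      qed (use 3 r1 i(3) in auto)
      then show ?thesis using that small by (simp add: prefix)
    qed
    ultimately show ?thesis by (intro less_funI exI[of _ "Suc e + i'"]) blast
  qed
qed

lemma infinite_of_reflected_tail_less:
  assumes "digits A c" "\<And>n. 0 < n \<Longrightarrow> less_fun (reflect A (shift_seq n c)) c"
  shows "infinite_seq c"
proof
  assume "finite_seq c"
  then obtain n where "shift_seq n c = (\<lambda>_. 0)" using finite_seq_imp_tail_zero by blast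
  then have "shift_seq (Suc n) c = (\<lambda>_. 0)"
    using shift_seq_shift_seq[of 1 n c] by (simp add: shift_seq_def)
  then have "less_fun (\<lambda>_. A) c" using assms(2)[of "Suc n"] by (simp add: reflect_def)
  then show False using assms(1) by (auto simp: digits_def elim!: less_funE) (meson leD)
qed

text \<open>
  If \<open>\<alpha>\<close> is not periodic, \<open>\<alpha>\<close> itself is the only expansion of 1. Otherwise the approximants built from
  long good prefixes satisfy the strict inequalities for a univoque base, and each of them is
  an expansion of 1 in some base slightly below \<open>q\<close>.
\<close>

lemma in_closure_univoque_bases:
  assumes strict: "\<And>n. 0 < n \<Longrightarrow> less_fun (reflect A (shift_seq n (alpha q))) (alpha q)"
  shows "q \<in> closure univoque_bases"
proof (cases "\<forall>n. shift_seq (Suc n) (alpha q) \<noteq> alpha q")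
  case True
  have "q \<in> univoque_bases"
  proof (rule univoque_base_of_less_fun[OF digits_alpha dval_alpha infinite_alpha])
    show "less_fun (shift_seq (Suc n) (alpha q)) (alpha q)" for n
      using shift_alpha_lex_le[of "Suc n"] True by (simp add: lex_le_def)
    show "less_fun (reflect A (shift_seq (Suc n) (alpha q))) (alpha q)" for n
      by (rule strict) simp
  qed
  then show ?thesis using closure_subset by blast
next
  case False
  then obtain p where p: "0 < p" "shift_seq p (alpha q) = alpha q" by blast
  have strict': "less_fun (reflect A (shift_seq n (alpha q))) (alpha q)" for n
    using strict[of n] strict[OF p(1)] p(2) by (cases "n = 0") auto
  obtain L where gap: "\<And>n. \<exists>i<L. A - alpha q (n + i) < alpha q i \<and> (\<forall>j<i. A - alpha q (n + j) = alpha q j)"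
    using uniform_reflection_gap[OF strict' p] by blast
  show ?thesis
    unfolding closure_approachable
  proof (intro allI impI)
    fix e :: real
    assume "0 < e"
    \<comment> \<open>Between \<open>s\<close> and \<open>q\<close> the digit set remains \<open>{0..A}\<close>.\<close>
    define s where "s = (max (max 1 (real A)) (q - e) + q) / 2"
    have s: "1 < s" "real A < s" "q - e < s" "s < q"
      using q_gt_1 A_less \<open>0 < e\<close> by (auto simp: s_def)
    interpret s: base s A
      using s q_le by unfold_locales auto
    have "1 < dval s (alpha q)"
      using dval_less_smaller_base[OF digits_alpha _ s.base_axioms s(4)] alpha_0 A_pos dval_alpha by simp
    then have "\<forall>\<^sub>F n in sequentially. 1 < (\<Sum>i<n. real (alpha q i) / s ^ Suc i)"
      using s.dval_sums[OF digits_alpha] by (intro order_tendstoD(1)) (auto simp: sums_def)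
    then obtain N where N: "1 < (\<Sum>i<N. real (alpha q i) / s ^ Suc i)"
      by (auto simp: eventually_sequentially)
    obtain m where m: "2 * L + 2 \<le> m" "good_prefix m" using good_prefix_exists[OF strict'] by blast
    obtain M where M: "m + N + 1 \<le> M" "good_prefix M" using good_prefix_exists[OF strict'] by blast
    define c where "c = approximant M m"
    have c: "digits A c" unfolding c_def by (rule digits_approximant)
    have up: "less_fun (shift_seq n c) c" if "0 < n" for n
      unfolding c_def using m M that by (intro approximant_tail_less) auto
    have down: "less_fun (reflect A (shift_seq n c)) c" if "0 < n" for n
      unfolding c_def using m M that gap by (intro approximant_reflected_tail_less[of m M L n]) auto
    have inf: "infinite_seq c" using c down by (rule infinite_of_reflected_tail_less)
    have "0 < alpha q (M - 1)" using M by (intro good_prefix_last_pos) auto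
    then have "less_fun c (alpha q)"
      unfolding c_def using M
      by (intro less_funI exI[of _ "M - 1"]) (auto simp: approximant_def)
    then have below: "lex_le c (alpha q)" by (simp add: lex_le_def)
    have "dval q c \<le> 1"
    proof -
      \<comment> \<open>A digit 0 in front makes \<open>c\<close> itself a tail that follows a digit below \<open>A\<close>.\<close>
      have "shift_seq (Suc 0) (case_nat 0 c) = c" by (simp add: shift_seq_def)
      moreover have "lex_le (shift_seq (Suc n) (case_nat 0 c)) (alpha q)" for n
      proof -
        have "lex_le (shift_seq n c) c" using up[of n] by (cases "n = 0") (auto simp: lex_le_def)
        then have "lex_le (shift_seq n c) (alpha q)" using below by (rule lex_le_trans)
        then show ?thesis by (simp add: shift_seq_def)
      qed
      moreover have "digits A (case_nat 0 c)"
        using c by (simp add: digits_def split: nat.split)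
      ultimately show ?thesis
        using dval_shift_le_1[OF digits_alpha infinite_alpha dval_alpha, of "case_nat 0 c" 0] A_pos by simp
    qed
    moreover have "1 \<le> dval s c"
    proof -
      have "(\<Sum>i<N. real (alpha q i) / s ^ Suc i) = (\<Sum>i<N. real (c i) / s ^ Suc i)"
        using M m by (intro sum.cong) (auto simp: c_def approximant_prefix)
      moreover have "0 \<le> dval s (shift_seq N c) / s ^ N"
        using s(1) c by (intro divide_nonneg_pos s.dval_nonneg digits_shift) auto
      ultimately show ?thesis using N s.dval_split[OF c, of N] by linarith
    qed
    moreover have "continuous_on {s..q} (\<lambda>s. dval s c)"
      using s.continuous_on_dval_base[OF c] by (rule continuous_on_subset) auto
    ultimately obtain r where r: "s \<le> r" "r \<le> q" "dval r c = 1"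
      using IVT2'[of "\<lambda>s. dval s c" q 1 s] s(4) by auto
    interpret r: base r A
      using r(1,2) s q_le by unfold_locales auto
    have "r \<in> univoque_bases"
      using c r(3) inf up down by (intro r.univoque_base_of_less_fun) auto
    moreover have "dist r q < e" using r(1,2) s(3) by (simp add: dist_real_def)
    ultimately show "\<exists>y\<in>univoque_bases. dist y q < e" by blast
  qed
qed

end

section \<open>The topology of the two sets\<close>

theorem theorem1p4:
  fixes q :: real
  assumes "q > 1"
    and "q \<in> V_bases - closure univoque_bases"
  shows "(closed (U_set q) \<and> closed (V_set q)) \<and>
         ((V_set q - U_set q) \<approx> (UNIV :: nat set) \<and>
          discrete (V_set q - U_set q) \<and>
          V_set q \<subseteq> closure (V_set q - U_set q)) \<and>
         (\<forall>x \<in> V_set q - U_set q.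
           {c. is_expansion q x c} \<approx> (UNIV :: nat set) \<and>
           (\<exists>c. is_greedy_expansion q x c \<and> finite_seq c))"
proof -
  define A where "A = nat (\<lceil>q\<rceil> - 1)"
  have "real A = of_int \<lceil>q\<rceil> - 1" using assms(1) by (simp add: A_def)
  then interpret base q A
    using assms(1) by unfold_locales linarith+
  have le: "lex_le (reflect A (shift_seq n (alpha q))) (alpha q)" if "0 < n" for n
    using assms(2) that by (simp add: V_bases_def conj_seq_eq)
  obtain k where k: "0 < k" "reflect A (shift_seq k (alpha q)) = alpha q"
  proof (rule ccontr)
    assume "\<not> thesis"
    then have "less_fun (reflect A (shift_seq n (alpha q))) (alpha q)" if "0 < n" for n
      using le[OF that] that \<open>\<And>k. 0 < k \<Longrightarrow> reflect A (shift_seq k (alpha q)) = alpha q \<Longrightarrow> thesis\<close>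
      by (auto simp: lex_le_def)
    then have "q \<in> closure univoque_bases" by (rule in_closure_univoque_bases)
    with assms(2) show False by simp
  qed
  interpret reflected_base q A k
    using k le by unfold_locales
  have "{c. is_expansion q x c} \<approx> (UNIV :: nat set) \<and> (\<exists>c. is_greedy_expansion q x c \<and> finite_seq c)"
    if "x \<in> V_set q - U_set q" for x
  proof -
    obtain a where a: "a \<in> V_seqs - U_seqs" "x = dval q a" using \<open>x \<in> V_set q - U_set q\<close> V_minus_U_eq by blast
    then have "{c. is_expansion q x c} \<approx> (UNIV :: nat set)"
      using countable_expansions[of a] infinite_expansions[OF a(1)] by (intro eqpoll_UNIV_nat) auto
    then show ?thesis using finite_greedy_expansion[OF a(1)] a(2) by simp
  qed
  then show ?thesis
    using closed_U_set closed_V_set discrete_V_minus_U V_set_subset_closure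
      eqpoll_UNIV_nat[OF countable_V_minus_U infinite_V_minus_U] by blast
qed

end
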